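(* Let $X$ be a compact Hausdorff space such that the weight $w(X)$ is a regular (infinite) cardinal and $X$ does not map continuously onto the Tychonoff cube $[0,1]^{w(X)}$. Then $\mathrm{Nt}(X^n)=\mathrm{Nt}(X)$ for every positive integer $n$.
   Context: For a cardinal $\kappa$, a family $\mathcal B$ of sets is called $\kappa^{\mathrm{op}}$-like if for every $U\in\mathcal B$ the set $\{V\in\mathcal B: U\subseteq V\}$ has cardinality $<\kappa$. The Noetherian type $\mathrm{Nt}(X)$ of a topological space $X$ is the least infinite cardinal $\kappa$ such that $X$ has a base which is $\kappa^{\mathrm{op}}$-like. The weight $w(X)$ is the least cardinality of a base of $X$. $X^n$ carries the product topology. *)

theory Defs
  imports "HOL-Analysis.Analysis"
begin

unbundle cardinal_syntax
no_notation elt_set_eq (infix \<open>=o\<close> 50)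

definition topology_base :: "'a topology \<Rightarrow> 'a set set \<Rightarrow> bool" where
  "topology_base X \<B> \<longleftrightarrow>
     (\<forall>V\<in>\<B>. openin X V) \<and>
     (\<forall>U x. openin X U \<and> x \<in> U \<longrightarrow> (\<exists>V\<in>\<B>. x \<in> V \<and> V \<subseteq> U))"

definition op_like :: "'k rel \<Rightarrow> 'a set set \<Rightarrow> bool" where
  "op_like \<kappa> \<B> \<longleftrightarrow> (\<forall>U\<in>\<B>. |{V \<in> \<B>. U \<subseteq> V}| <o \<kappa>)"

text \<open>
  Cardinals are represented, as in the cardinal library of Main, by cardinal orders on subsets of
  some type, and are compared up to order isomorphism. The least cardinal is
  therefore an arbitrary representative, and it is only meaningful if some cardinal on the type at
  hand has the property.
\<close>

definition is_least_cardinal :: "('k rel \<Rightarrow> bool) \<Rightarrow> 'k rel \<Rightarrow> bool" where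
  "is_least_cardinal P \<kappa> \<longleftrightarrow>
     Card_order \<kappa> \<and> P \<kappa> \<and> (\<forall>\<mu>. Card_order \<mu> \<and> P \<mu> \<longrightarrow> \<kappa> \<le>o \<mu>)"

definition least_cardinal :: "('k rel \<Rightarrow> bool) \<Rightarrow> 'k rel" where
  "least_cardinal P = (SOME \<kappa>. is_least_cardinal P \<kappa>)"

definition weight :: "'a topology \<Rightarrow> 'a set rel" where
  "weight X = least_cardinal (\<lambda>\<kappa>. \<exists>\<B>. topology_base X \<B> \<and> |\<B>| =o \<kappa>)"

text \<open>
  The type in the next definition is large enough for every space: it carries \<open>\<omega>\<close>
  and, for each infinite base \<open>\<B>\<close>, the successor cardinal of \<open>\<B>\<close>,
  for which \<open>\<B>\<close> is trivially \<open>op_like\<close>. The lemmas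
  \<open>weight_least\<close> and \<open>noetherian_type_least\<close> below show that the minimality does not
  depend on the choice of the carrier types.
\<close>

definition noetherian_type :: "'a topology \<Rightarrow> (nat + 'a set set) rel" where
  "noetherian_type X =
     least_cardinal (\<lambda>\<kappa>. cinfinite \<kappa> \<and> (\<exists>\<B>. topology_base X \<B> \<and> op_like \<kappa> \<B>))"

lemma least_cardinal_is_least:
  assumes "Card_order \<kappa>" "P \<kappa>"
  shows "is_least_cardinal P (least_cardinal P)"
proof -
  have "\<exists>r\<in>{\<mu>. Card_order \<mu> \<and> P \<mu>}. \<forall>r'\<in>{\<mu>. Card_order \<mu> \<and> P \<mu>}. r \<le>o r'"
    by (rule exists_minim_Card_order) (use assms in auto)
  then have "\<exists>r. is_least_cardinal P r"
    unfolding is_least_cardinal_def by blast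
  then show ?thesis
    unfolding least_cardinal_def by (rule someI_ex)
qed

lemma ex_topology_base: "topology_base X {U. openin X U}"
  unfolding topology_base_def by blast

lemma weight_is_least:
  "is_least_cardinal (\<lambda>\<kappa>. \<exists>\<B>. topology_base X \<B> \<and> |\<B>| =o \<kappa>) (weight X)"
  unfolding weight_def
proof (rule least_cardinal_is_least)
  show "Card_order |{U. openin X U}|"
    by (rule card_of_Card_order)
  show "\<exists>\<B>. topology_base X \<B> \<and> |\<B>| =o |{U. openin X U}|"
    by (intro exI conjI) (rule ex_topology_base, rule card_of_refl)
qed

lemma Card_order_weight: "Card_order (weight X)"
  using weight_is_least unfolding is_least_cardinal_def by blast

lemma weight_attained: "\<exists>\<B>. topology_base X \<B> \<and> |\<B>| =o weight X"
  using weight_is_least[of X] unfolding is_least_cardinal_def by blast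

lemma weight_least:
  assumes "topology_base X \<B>"
  shows "weight X \<le>o |\<B>|"
  using weight_is_least[of X] assms card_of_Card_order[of \<B>] card_of_refl[of \<B>]
  unfolding is_least_cardinal_def by blast

lemma noetherian_type_is_least:
  "is_least_cardinal (\<lambda>\<kappa>. cinfinite \<kappa> \<and> (\<exists>\<B>. topology_base X \<B> \<and> op_like \<kappa> \<B>))
     (noetherian_type X)"
proof -
  define \<B> where "\<B> = {U. openin X U}"
  define K :: "(nat + 'a set set) set" where "K = UNIV <+> Field (cardSuc |\<B>| )"
  have "|\<B>| <o cardSuc |\<B>|"
    by (simp add: cardSuc_greater card_of_Card_order)
  also have "cardSuc |\<B>| =o |Field (cardSuc |\<B>| )|"
    by (meson cardSuc_Card_order card_of_Card_order card_of_Field_ordIso ordIso_symmetric)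
  also have "|Field (cardSuc |\<B>| )| \<le>o |K|"
    unfolding K_def by (rule card_of_Plus2)
  finally have less: "|\<B>| <o |K|" .
  have base: "topology_base X \<B>"
    unfolding \<B>_def by (rule ex_topology_base)
  have op: "op_like |K| \<B>"
    unfolding op_like_def
  proof
    fix U assume "U \<in> \<B>"
    have "|{V \<in> \<B>. U \<subseteq> V}| \<le>o |\<B>|"
      by (rule card_of_mono1) blast
    then show "|{V \<in> \<B>. U \<subseteq> V}| <o |K|"
      using less by (rule ordLeq_ordLess_trans)
  qed
  have inf: "cinfinite |K|"
    by (simp add: cinfinite_def K_def Field_card_of)
  show ?thesis
    unfolding noetherian_type_def
    by (rule least_cardinal_is_least[OF card_of_Card_order[of K]])
       (use inf base op in blast)
qed

lemma Card_order_noetherian_type: "Card_order (noetherian_type X)"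
  and cinfinite_noetherian_type: "cinfinite (noetherian_type X)"
  and noetherian_type_attained: "\<exists>\<B>. topology_base X \<B> \<and> op_like (noetherian_type X) \<B>"
  using noetherian_type_is_least[of X] unfolding is_least_cardinal_def by blast+

lemma op_like_cong:
  assumes "\<kappa> =o \<mu>" "op_like \<kappa> \<B>"
  shows "op_like \<mu> \<B>"
  unfolding op_like_def
proof
  fix U assume "U \<in> \<B>"
  then have "|{V \<in> \<B>. U \<subseteq> V}| <o \<kappa>"
    using assms(2) unfolding op_like_def by simp
  then show "|{V \<in> \<B>. U \<subseteq> V}| <o \<mu>"
    using assms(1) by (rule ordLess_ordIso_trans)
qed

lemma noetherian_type_least:
  fixes \<kappa> :: "'k rel"
  assumes "Card_order \<kappa>" "cinfinite \<kappa>" "topology_base X \<B>" "op_like \<kappa> \<B>"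
  shows "noetherian_type X \<le>o \<kappa>"
proof (rule ccontr)
  assume "\<not> noetherian_type X \<le>o \<kappa>"
  then have less: "\<kappa> <o noetherian_type X"
    using assms(1) Card_order_noetherian_type[of X] not_ordLeq_iff_ordLess
    by (metis card_order_on_well_order_on)
  then have "|Field \<kappa>| \<le>o |Field (noetherian_type X)|"
    by (simp add: card_of_mono2 ordLess_imp_ordLeq)
  then obtain f where f: "inj_on f (Field \<kappa>)" "f ` Field \<kappa> \<subseteq> Field (noetherian_type X)"
    using card_of_ordLeq by metis
  define \<mu> where "\<mu> = |f ` Field \<kappa>|"
  have "|Field \<kappa>| =o \<mu>"
    unfolding \<mu>_def using f(1) card_of_ordIso inj_on_imp_bij_betw by blast
  then have iso: "\<kappa> =o \<mu>"
    using assms(1) card_of_Field_ordIso ordIso_symmetric ordIso_transitive by blast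
  have "cinfinite \<mu>"
    using assms(2) f(1) by (simp add: cinfinite_def \<mu>_def Field_card_of finite_image_iff)
  moreover have "Card_order \<mu>"
    by (simp add: \<mu>_def card_of_Card_order)
  ultimately have "noetherian_type X \<le>o \<mu>"
    using noetherian_type_is_least[of X] op_like_cong[OF iso assms(4)] assms(3)
    unfolding is_least_cardinal_def by blast
  then show False
    using less iso not_ordLess_ordLeq ordIso_symmetric ordLeq_ordIso_trans by blast
qed

end

theory Submission
  imports Defs
begin

text \<open>
  Write \<open>\<kappa>\<close> for the weight of \<open>X\<close>. The inequality \<open>Nt(X\<^sup>n) \<le> Nt(X)\<close> holds for every space, as the
  boxes over a good base of \<open>X\<close> are a good base of the power (\<open>noetherian_type_power_le\<close>).
  The converse holds because \<open>Nt(X\<^sup>n)\<close> is extreme: it is at least \<open>\<omega>\<close> by definition, and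
  \<open>Nt(X) \<le> \<omega>\<close> if \<open>\<kappa> = \<omega>\<close> (\<open>second_countable_compact_base\<close>); and if \<open>\<kappa>\<close> is uncountable, then
  \<open>Nt(X\<^sup>n)\<close> exceeds \<open>\<kappa>\<close>, whereas a base of size \<open>\<kappa>\<close> is trivially \<open>\<nu>\<close>-op-like for every \<open>\<nu> > \<kappa>\<close>.

  The heart of the matter is thus the following claim (\<open>maps_onto_cube_if_power_op_like\<close>): if \<open>\<kappa>\<close> is
  regular and uncountable and some power of \<open>X\<close> has a \<open>\<kappa>\<close>-op-like base, then \<open>X\<close> maps onto the cube
  \<open>[0,1]\<^sup>\<kappa>\<close>. Such a map exists as soon as there are \<open>\<kappa>\<close> independent pairs of open sets, the two sets
  of each pair having disjoint closures. They are found by extending a family of pairs step by step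
  inside a fixed nonempty open set \<open>G\<close>; the extension is possible if, for any family \<open>\<A>\<close> of fewer than \<open>\<kappa>\<close>
  nonempty open subsets of \<open>G\<close>, there are two open sets with disjoint closures that both meet every
  member of \<open>\<A>\<close>.

  That some \<open>G\<close> has this property (\<open>ex_open_set_split_everywhere\<close>) follows by an elementary submodel
  argument. Let \<open>\<A>\<close> be the open sets in a small elementary submodel. As the given base is
  \<open>\<kappa>\<close>-op-like, a basic set that contains a set in the submodel belongs to the submodel itself. Hence
  at a point where \<open>\<A>\<close> is not a local base, it is not even a local \<open>\<pi>\<close>-base: some
  neighbourhood contains no member of \<open>\<A>\<close>. Now \<open>\<A>\<close>, being smaller than the weight, is not
  a base; so there is a nonempty closed set of points, not separated by \<open>\<A>\<close>, each with such
  a neighbourhood, and a finite cover by these neighbourhoods, reduced to two sets, yields the two open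
  sets.
\<close>

section \<open>Cardinal arithmetic\<close>

lemma ordLess_finite:
  assumes "finite A" "Card_order \<kappa>" "cinfinite \<kappa>"
  shows "|A| <o \<kappa>"
  using assms by (intro Cfinite_ordLess_Cinfinite) (auto simp: cfinite_def Field_card_of card_of_card_order_on)

lemma cinfinite_if_natLeq_less:
  assumes "Card_order \<kappa>" "natLeq <o \<kappa>"
  shows "cinfinite \<kappa>"
  using assms by (metis Cinfinite_limit2 Field_natLeq cinfinite_def cinfinite_mono natLeq_Cinfinite ordLess_imp_ordLeq)

lemma card_of_lists_ordLeq:
  assumes "infinite A"
  shows "|lists A| \<le>o |A|"
proof -
  have "|{xs \<in> lists A. length xs = n}| \<le>o |A|" for n
  proof (induction n)
    case 0
    have "{xs \<in> lists A. length xs = 0} = {[]}"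
      by auto
    then show ?case
      using assms by (metis card_of_singl_ordLeq finite.emptyI)
  next
    case (Suc n)
    let ?L = "\<lambda>n. {xs \<in> lists A. length xs = n}"
    have "?L (Suc n) = (\<lambda>(x, xs). x # xs) ` (A \<times> ?L n)"
      by (auto simp: length_Suc_conv image_iff)
    then have "|?L (Suc n)| \<le>o |A \<times> ?L n|"
      by (simp add: card_of_image)
    also have "|A \<times> ?L n| \<le>o |A|"
      using Suc assms by (intro card_of_Times_ordLeq_infinite_Field)
        (auto simp: Field_card_of card_of_card_order_on intro: ordIso_imp_ordLeq card_of_refl)
    finally show ?case .
  qed
  then have "|\<Union>n. {xs \<in> lists A. length xs = n}| \<le>o |A|"
    using assms by (intro card_of_UNION_ordLeq_infinite)
      (auto simp: infinite_iff_card_of_nat)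
  moreover have "lists A = (\<Union>n. {xs \<in> lists A. length xs = n})"
    by auto
  ultimately show ?thesis by metis
qed

lemma card_of_finite_subsets_ordLess:
  assumes "Card_order \<kappa>" "cinfinite \<kappa>" "|A| <o \<kappa>"
  shows "|{F. finite F \<and> F \<subseteq> A}| <o \<kappa>"
proof (cases "finite A")
  case True
  then show ?thesis
    using assms by (intro ordLess_finite) auto
next
  case False
  have "|{F. finite F \<and> F \<subseteq> A}| \<le>o |lists A|"
    unfolding Collect_finite_subset_eq_lists by (rule card_of_image)
  also have "|lists A| \<le>o |A|"
    using False by (rule card_of_lists_ordLeq)
  finally show ?thesis
    using assms(3) by (rule ordLeq_ordLess_trans)
qed

lemma card_of_tuples_ordLess:
  fixes n :: nat
  assumes "Card_order \<kappa>" "cinfinite \<kappa>" "|A| <o \<kappa>"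
  shows "|{..<n} \<rightarrow>\<^sub>E A| <o \<kappa>"
proof (cases "finite A")
  case True
  then show ?thesis
    using assms by (intro ordLess_finite finite_PiE) auto
next
  case False
  have "{..<n} \<rightarrow>\<^sub>E A \<subseteq> (\<lambda>xs. \<lambda>i\<in>{..<n}. xs ! i) ` lists A"
  proof
    fix f assume f: "f \<in> {..<n} \<rightarrow>\<^sub>E A"
    have "f = (\<lambda>i\<in>{..<n}. map f [0..<n] ! i)"
    proof
      fix i show "f i = (\<lambda>i\<in>{..<n}. map f [0..<n] ! i) i"
        using PiE_arb[OF f, of i] by (cases "i < n") auto
    qed
    moreover have "map f [0..<n] \<in> lists A"
      using PiE_mem[OF f] by (auto simp: in_lists_conv_set)
    ultimately show "f \<in> (\<lambda>xs. \<lambda>i\<in>{..<n}. xs ! i) ` lists A"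
      by (rule image_eqI)
  qed
  then have "|{..<n} \<rightarrow>\<^sub>E A| \<le>o |lists A|"
    by (rule surj_imp_ordLeq)
  also have "|lists A| \<le>o |A|"
    using False by (rule card_of_lists_ordLeq)
  finally show ?thesis
    using assms(3) by (rule ordLeq_ordLess_trans)
qed

text \<open>
  The downward Loewenheim-Skolem argument: starting from one element, close under \<open>\<Phi>\<close>
  in \<open>\<omega>\<close> steps. Regularity keeps each step below \<open>\<kappa>\<close>, and uncountable cofinality keeps the
  limit below \<open>\<kappa>\<close>. The last conclusion transfers to the closed set whatever
  all values of \<open>\<Phi>\<close> have in common.
\<close>

lemma ex_small_closed_set:
  fixes \<Phi> :: "'b \<Rightarrow> 'b \<Rightarrow> 'b set" and \<kappa> :: "'k rel"
  assumes \<kappa>: "Card_order \<kappa>" "natLeq <o \<kappa>" "regularCard \<kappa>"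
    and \<Phi>: "\<And>x y. |\<Phi> x y| <o \<kappa>"
  obtains A where "a \<in> A" "|A| <o \<kappa>" "\<And>x y. \<lbrakk>x \<in> A; y \<in> A\<rbrakk> \<Longrightarrow> \<Phi> x y \<subseteq> A"
    "A \<subseteq> insert a (\<Union>x y. \<Phi> x y)"
proof -
  have inf: "cinfinite \<kappa>"
    using \<kappa>(1,2) by (rule cinfinite_if_natLeq_less)
  define A where "A = rec_nat {a} (\<lambda>_ S. S \<union> (\<Union>x\<in>S. \<Union>y\<in>S. \<Phi> x y))"
  have A_0: "A 0 = {a}" and A_Suc: "A (Suc n) = A n \<union> (\<Union>x\<in>A n. \<Union>y\<in>A n. \<Phi> x y)" for n
    by (simp_all add: A_def)
  have union: "|\<Union>i\<in>I. S i| <o \<kappa>" if "|I| <o \<kappa>" "\<And>i. i \<in> I \<Longrightarrow> |S i| <o \<kappa>"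
    for I :: "'i set" and S :: "'i \<Rightarrow> 'b set"
    using card_of_UNION_ordLess_infinite_Field_regularCard[of \<kappa> I S] \<kappa> inf that by blast
  have "|A n| <o \<kappa>" for n
  proof (induction n)
    case 0
    then show ?case
      using \<kappa> inf by (simp add: A_0 ordLess_finite)
  next
    case (Suc n)
    have "|\<Union>x\<in>A n. \<Union>y\<in>A n. \<Phi> x y| <o \<kappa>"
      using Suc \<Phi> by (intro union)
    then show ?case
      unfolding A_Suc using Suc \<kappa> inf
      by (intro card_of_Un_ordLess_infinite_Field) (auto simp: cinfinite_def)
  qed
  moreover have "|UNIV :: nat set| <o \<kappa>"
    using \<kappa>(2) card_of_nat ordIso_ordLess_trans by blast
  ultimately have small: "|\<Union>n. A n| <o \<kappa>"
    by (intro card_of_UNION_ordLess_infinite_Field_regularCard) (use \<kappa> inf in auto)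
  have "mono A"
    by (rule incseq_SucI) (auto simp: A_Suc)
  have closed: "\<Phi> x y \<subseteq> (\<Union>n. A n)" if "x \<in> (\<Union>n. A n)" "y \<in> (\<Union>n. A n)" for x y
  proof -
    from that obtain i j where "x \<in> A i" "y \<in> A j"
      by blast
    then have "x \<in> A (max i j)" "y \<in> A (max i j)"
      using \<open>mono A\<close> by (meson max.cobounded1 max.cobounded2 monoD subsetD)+
    then have "\<Phi> x y \<subseteq> A (Suc (max i j))"
      unfolding A_Suc by (intro le_supI2 UN_I subsetI) auto
    then show ?thesis
      by (rule order_trans) (rule UN_upper, simp)
  qed
  have "A n \<subseteq> insert a (\<Union>x y. \<Phi> x y)" for n
    by (induction n) (auto simp: A_0 A_Suc)
  then have "(\<Union>n. A n) \<subseteq> insert a (\<Union>x y. \<Phi> x y)"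
    by (rule UN_least)
  moreover have "a \<in> (\<Union>n. A n)"
    using A_0 by (intro UN_I[of 0]) simp_all
  ultimately show thesis
    using small closed by (intro that)
qed

section \<open>From independent families to maps onto a cube\<close>

lemma binary_expansion:
  fixes y :: real
  assumes "0 \<le> y" "y \<le> 1"
  obtains e :: "nat \<Rightarrow> bool" where "(\<lambda>n. of_bool (e n) / 2 ^ Suc n) sums y"
proof -
  \<comment> \<open>\<open>r n\<close> is the fractional part that is left after \<open>n\<close> digits, scaled back to the unit interval.\<close>
  define r where "r = rec_nat y (\<lambda>_ s. 2 * s - of_bool (s \<ge> 1 / 2))"
  have r_0: "r 0 = y" and r_Suc: "r (Suc n) = 2 * r n - of_bool (r n \<ge> 1 / 2)" for n
    by (simp_all add: r_def)
  have r: "0 \<le> r n \<and> r n \<le> 1" for n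
    by (induction n) (use assms in \<open>auto simp: r_0 r_Suc\<close>)
  have sum: "(\<Sum>k<n. of_bool (r k \<ge> 1 / 2) / 2 ^ Suc k) = y - r n * (1 / 2) ^ n" for n
    by (induction n) (auto simp: r_0 r_Suc field_simps)
  have "(\<lambda>n. r n * (1 / 2) ^ n) \<longlonglongrightarrow> 0"
  proof (rule Lim_null_comparison)
    show "\<forall>\<^sub>F n in sequentially. norm (r n * (1 / 2) ^ n) \<le> (1 / 2 :: real) ^ n"
      using r by (intro always_eventually) (auto simp: abs_mult mult_left_le_one_le)
  qed (simp add: LIMSEQ_power_zero)
  then have "(\<lambda>n. y - r n * (1 / 2) ^ n) \<longlonglongrightarrow> y - 0"
    by (intro tendsto_intros)
  then have "(\<lambda>k. of_bool (r k \<ge> 1 / 2) / 2 ^ Suc k) sums y"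
    unfolding sums_def sum by simp
  then show thesis
    by (rule that)
qed

lemma continuous_map_binary_sum:
  fixes u :: "nat \<Rightarrow> 'a \<Rightarrow> real"
  assumes "\<And>n. continuous_map X (top_of_set {0..1}) (u n)"
  shows "continuous_map X (top_of_set {0..1}) (\<lambda>x. \<Sum>n. u n x / 2 ^ Suc n)"
proof -
  have u: "continuous_map X euclideanreal (u n)" "x \<in> topspace X \<Longrightarrow> u n x \<in> {0..1}" for n x
    using assms[of n] by (auto simp: continuous_map_in_subtopology)
  have geometric: "(\<lambda>n. 1 / 2 ^ Suc n) sums (1 :: real)"
    using power_half_series by (simp add: power_divide)
  have bound: "\<bar>u n x / 2 ^ Suc n\<bar> \<le> 1 / 2 ^ Suc n" if "x \<in> topspace X" for n x
    using u(2)[OF that, of n] by (simp add: divide_right_mono)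
  have lim: "uniform_limit (topspace X) (\<lambda>n x. \<Sum>k<n. u k x / 2 ^ Suc k)
      (\<lambda>x. \<Sum>k. u k x / 2 ^ Suc k) sequentially"
    using bound geometric by (intro Weierstrass_m_test) (auto simp: sums_iff)
  have "continuous_map X Met_TC.mtopology (\<lambda>x. \<Sum>k. u k x / 2 ^ Suc k)"
  proof (rule Met_TC.continuous_map_uniform_limit)
    show "\<forall>\<^sub>F n in sequentially. continuous_map X Met_TC.mtopology (\<lambda>x. \<Sum>k<n. u k x / 2 ^ Suc k)"
      using u(1) unfolding mtopology_is_euclidean divide_inverse
      by (intro always_eventually allI continuous_map_sum continuous_map_real_mult_right) auto
    show "\<forall>\<^sub>F n in sequentially. \<forall>x\<in>topspace X. (\<Sum>k. u k x / 2 ^ Suc k) \<in> UNIV \<and>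
        dist (\<Sum>k<n. u k x / 2 ^ Suc k) (\<Sum>k. u k x / 2 ^ Suc k) < \<epsilon>" if "0 < \<epsilon>" for \<epsilon> :: real
      using uniform_limitD[OF lim that] by simp
  qed simp
  moreover have "(\<Sum>k. u k x / 2 ^ Suc k) \<in> {0..1}" if x: "x \<in> topspace X" for x
  proof -
    have summable: "summable (\<lambda>k. u k x / 2 ^ Suc k)"
      using bound[OF x] by (intro summable_comparison_test'[OF sums_summable[OF geometric], of 0]) simp
    have "(\<Sum>k. u k x / 2 ^ Suc k) \<le> (\<Sum>k. 1 / 2 ^ Suc k)"
      using u(2)[OF x] geometric
      by (intro suminf_le summable) (auto simp: sums_iff divide_right_mono)
    moreover have "0 \<le> (\<Sum>k. u k x / 2 ^ Suc k)"
      using u(2)[OF x] by (intro suminf_nonneg summable) auto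
    ultimately show ?thesis
      using geometric by (simp add: sums_iff)
  qed
  ultimately show ?thesis
    by (auto simp: continuous_map_in_subtopology)
qed

text \<open>
  A pair of closed sets \<open>C i n False\<close>, \<open>C i n True\<close> controls the \<open>n\<close>-th binary digit of the \<open>i\<close>-th
  coordinate: a Urysohn function \<open>u i n\<close> takes the values 0 and 1 on them, and the \<open>i\<close>-th coordinate
  of the map is the sum of the \<open>u i n\<close> weighted by powers of one half. By independence and
  compactness, any prescribed digits are realised at some point, so every point of the cube is hit.
  Summing the Urysohn functions on all of \<open>X\<close> gives a map defined on \<open>X\<close> at once, so that
  nothing has to be extended from a closed subset.
\<close>

lemma maps_onto_cube:
  fixes X :: "'a topology" and I :: "'i set"
  assumes X: "compact_space X" "normal_space X"
    and closed: "\<And>i (n :: nat) b. i \<in> I \<Longrightarrow> closedin X (C i n b)"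
    and disj: "\<And>i n. i \<in> I \<Longrightarrow> disjnt (C i n False) (C i n True)"
    and indep: "\<And>F e. finite F \<Longrightarrow> F \<subseteq> I \<times> (UNIV :: nat set) \<Longrightarrow> topspace X \<inter> (\<Inter>(i, n)\<in>F. C i n (e i n)) \<noteq> {}"
  shows "\<exists>f. continuous_map X (product_topology (\<lambda>_. top_of_set {0..1::real}) I) f \<and>
    f ` topspace X = topspace (product_topology (\<lambda>_. top_of_set {0..1::real}) I)"
proof -
  have "\<exists>v. continuous_map X (top_of_set {0..1::real}) v \<and>
      v ` C i n False \<subseteq> {0} \<and> v ` C i n True \<subseteq> {1}" if "i \<in> I" for i n
    using Urysohn_lemma[of X "C i n False" "C i n True" 0 1] X closed disj that
    by (metis zero_le_one)
  then obtain u where u: "\<And>i n. i \<in> I \<Longrightarrow> continuous_map X (top_of_set {0..1::real}) (u i n)"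
      "\<And>i n. i \<in> I \<Longrightarrow> u i n ` C i n False \<subseteq> {0}" "\<And>i n. i \<in> I \<Longrightarrow> u i n ` C i n True \<subseteq> {1}"
    by metis
  define f where "f = (\<lambda>x. \<lambda>i\<in>I. \<Sum>n. u i n x / 2 ^ Suc n)"
  have cont: "continuous_map X (product_topology (\<lambda>_. top_of_set {0..1::real}) I) f"
    using continuous_map_binary_sum[OF u(1)] by (auto simp: continuous_map_componentwise f_def)
  have "y \<in> f ` topspace X" if y: "y \<in> I \<rightarrow>\<^sub>E {0..1::real}" for y
  proof -
    have "\<exists>e. (\<lambda>n. of_bool (e n) / 2 ^ Suc n) sums y i" if "i \<in> I" for i
      using PiE_mem[OF y that] by (metis atLeastAtMost_iff binary_expansion)
    then obtain e where e: "\<And>i. i \<in> I \<Longrightarrow> (\<lambda>n. of_bool (e i n) / 2 ^ Suc n) sums y i"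
      by metis
    define \<U> where "\<U> = (\<lambda>(i, n). C i n (e i n)) ` (I \<times> UNIV)"
    have "topspace X \<inter> \<Inter>\<U> \<noteq> {}"
    proof (rule compactin_fip[THEN iffD1, THEN conjunct2, rule_format])
      show "compactin X (topspace X)"
        using X by (simp add: compact_space_def)
      show "(\<forall>C\<in>\<U>. closedin X C) \<and> (\<forall>\<F>. finite \<F> \<and> \<F> \<subseteq> \<U> \<longrightarrow> topspace X \<inter> \<Inter>\<F> \<noteq> {})"
      proof (intro conjI allI impI)
        show "\<forall>C\<in>\<U>. closedin X C"
          using closed by (auto simp: \<U>_def)
        fix \<F> assume "finite \<F> \<and> \<F> \<subseteq> \<U>"
        then obtain F where "F \<subseteq> I \<times> UNIV" "finite F" "\<F> = (\<lambda>(i, n). C i n (e i n)) ` F"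
          unfolding \<U>_def by (meson finite_subset_image)
        then show "topspace X \<inter> \<Inter>\<F> \<noteq> {}"
          using indep[of F e] by simp
      qed
    qed
    then obtain x where x: "x \<in> topspace X" "\<And>i n. i \<in> I \<Longrightarrow> x \<in> C i n (e i n)"
      unfolding \<U>_def by fastforce
    have "u i n x = of_bool (e i n)" if "i \<in> I" for i n
      using x(2)[OF that, of n] u(2,3)[OF that, of n] by (cases "e i n") auto
    then have "f x i = y i" if "i \<in> I" for i
      using e[OF that] that by (simp add: f_def sums_iff)
    then have "f x = y"
      using y by (intro extensionalityI[of _ I]) (auto simp: f_def PiE_def)
    then show ?thesis
      using x(1) by blast
  qed
  moreover have "f ` topspace X \<subseteq> I \<rightarrow>\<^sub>E {0..1}"
    using continuous_map_image_subset_topspace[OF cont] by simp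
  ultimately have "f ` topspace X = topspace (product_topology (\<lambda>_. top_of_set {0..1::real}) I)"
    by auto
  with cont show ?thesis by blast
qed

definition independent_pairs :: "'a set \<Rightarrow> ('a set \<times> 'a set) set \<Rightarrow> bool" where
  "independent_pairs G P \<longleftrightarrow>
     (\<forall>F e. finite F \<and> F \<subseteq> P \<longrightarrow> G \<inter> (\<Inter>p\<in>F. if e p then snd p else fst p) \<noteq> {})"

text \<open>
  A splitting pair for \<open>\<A>\<close> is the step by which an independent family grows: if \<open>\<A>\<close> contains
  all finite intersections of the sets chosen so far, the two new sets are independent of the old
  ones. For \<open>\<A> = {}\<close> only openness and disjointness of the closures remain.
\<close>

definition splitting_pair :: "'a topology \<Rightarrow> 'a set set \<Rightarrow> 'a set \<times> 'a set \<Rightarrow> bool" where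
  "splitting_pair X \<A> = (\<lambda>(V, W). openin X V \<and> openin X W \<and>
     disjnt (X closure_of V) (X closure_of W) \<and> (\<forall>U\<in>\<A>. U \<inter> V \<noteq> {} \<and> U \<inter> W \<noteq> {}))"

lemma splitting_pair_open:
  assumes "splitting_pair X \<A> p"
  shows "openin X (fst p)" "openin X (snd p)" "disjnt (X closure_of fst p) (X closure_of snd p)"
  using assms by (auto simp: splitting_pair_def)

text \<open>
  A maximal independent family has at least \<open>\<kappa>\<close> members. If it had fewer, its finite
  intersections inside \<open>G\<close> would be fewer than \<open>\<kappa>\<close> open sets, and a pair that splits them all could
  be added. The new pair is not an old one, because its first set meets the second set
  of every old pair but not its own.
\<close>

lemma ex_independent_pairs:
  fixes X :: "'a topology" and \<kappa> :: "'k rel"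
  assumes \<kappa>: "Card_order \<kappa>" "cinfinite \<kappa>"
    and G: "openin X G" "G \<noteq> {}"
    and split: "\<And>\<A>. \<lbrakk>|\<A>| <o \<kappa>; \<And>U. U \<in> \<A> \<Longrightarrow> openin X U \<and> U \<noteq> {} \<and> U \<subseteq> G\<rbrakk>
      \<Longrightarrow> \<exists>p. splitting_pair X \<A> p"
  obtains P where "independent_pairs G P" "\<And>p. p \<in> P \<Longrightarrow> splitting_pair X {} p" "\<kappa> \<le>o |P|"
proof -
  define \<P> where "\<P> = {P. independent_pairs G P \<and> (\<forall>p\<in>P. splitting_pair X {} p)}"
  have "{} \<in> \<P>"
    using G by (simp add: \<P>_def independent_pairs_def)
  moreover have "\<Union>\<C> \<in> \<P>" if chain: "\<C> \<noteq> {}" "subset.chain \<P> \<C>" for \<C>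
  proof -
    have "independent_pairs G (\<Union>\<C>)"
      unfolding independent_pairs_def
    proof (intro allI impI)
      fix F e assume "finite F \<and> F \<subseteq> \<Union>\<C>"
      then obtain P where "P \<in> \<C>" "F \<subseteq> P"
        using finite_subset_Union_chain[of F \<C> \<P>] chain by blast
      moreover have "independent_pairs G P"
        using \<open>P \<in> \<C>\<close> chain(2) by (auto simp: \<P>_def subset.chain_def)
      ultimately show "G \<inter> (\<Inter>p\<in>F. if e p then snd p else fst p) \<noteq> {}"
        using \<open>finite F \<and> F \<subseteq> \<Union>\<C>\<close> unfolding independent_pairs_def by blast
    qed
    then show ?thesis
      using chain(2) by (auto simp: \<P>_def subset.chain_def)
  qed
  ultimately obtain P where P: "P \<in> \<P>" "\<And>Q. Q \<in> \<P> \<Longrightarrow> P \<subseteq> Q \<Longrightarrow> Q = P"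
    using subset_Zorn_nonempty[of \<P>] by blast
  have "\<kappa> \<le>o |P|"
  proof (rule ccontr)
    assume "\<not> \<kappa> \<le>o |P|"
    then have small: "|P| <o \<kappa>"
      using \<kappa>(1) by (metis card_of_Well_order card_order_on_well_order_on not_ordLess_iff_ordLeq)
    define S where "S = fst ` P \<union> snd ` P"
    have "|fst ` P| <o \<kappa>" "|snd ` P| <o \<kappa>"
      using small by (auto intro: ordLeq_ordLess_trans[OF card_of_image])
    then have "|S| <o \<kappa>"
      unfolding S_def using \<kappa> by (intro card_of_Un_ordLess_infinite_Field) (auto simp: cinfinite_def)
    define \<A> where "\<A> = (\<lambda>F. G \<inter> \<Inter>F) ` {F. finite F \<and> F \<subseteq> S} - {{}}"
    have "|\<A>| \<le>o |(\<lambda>F. G \<inter> \<Inter>F) ` {F. finite F \<and> F \<subseteq> S}|"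
      unfolding \<A>_def by (rule card_of_mono1) blast
    also have "|(\<lambda>F. G \<inter> \<Inter>F) ` {F. finite F \<and> F \<subseteq> S}| \<le>o |{F. finite F \<and> F \<subseteq> S}|"
      by (rule card_of_image)
    also have "|{F. finite F \<and> F \<subseteq> S}| <o \<kappa>"
      using \<kappa> \<open>|S| <o \<kappa>\<close> by (rule card_of_finite_subsets_ordLess)
    finally have "|\<A>| <o \<kappa>" .
    moreover have "openin X U \<and> U \<noteq> {} \<and> U \<subseteq> G" if U: "U \<in> \<A>" for U
    proof -
      obtain F where F: "finite F" "F \<subseteq> S" "U = G \<inter> \<Inter>F"
        using U unfolding \<A>_def by blast
      have "openin X V" if "V \<in> S" for V
        using that P(1) by (auto simp: S_def \<P>_def splitting_pair_def)
      then have "openin X (\<Inter>(insert G F))"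
        using F G by (intro openin_Inter) auto
      then show ?thesis
        using F U by (auto simp: \<A>_def)
    qed
    ultimately obtain p where p: "splitting_pair X \<A> p"
      using split by blast
    have meets: "\<exists>U\<in>\<A>. U = G \<inter> (\<Inter>q\<in>F. if e q then snd q else fst q)"
      if F: "finite F" "F \<subseteq> P" for F e
    proof -
      have "G \<inter> (\<Inter>q\<in>F. if e q then snd q else fst q) \<noteq> {}"
        using F P(1) by (auto simp: \<P>_def independent_pairs_def)
      moreover have "(\<lambda>q. if e q then snd q else fst q) ` F \<in> {F. finite F \<and> F \<subseteq> S}"
        using F by (auto simp: S_def)
      ultimately show ?thesis
        unfolding \<A>_def by blast
    qed
    have "independent_pairs G (insert p P)"
      unfolding independent_pairs_def
    proof (intro allI impI)
      fix F and e :: "'a set \<times> 'a set \<Rightarrow> bool"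
      assume F: "finite F \<and> F \<subseteq> insert p P"
      obtain U where U: "U \<in> \<A>" "U = G \<inter> (\<Inter>q\<in>F - {p}. if e q then snd q else fst q)"
        using meets[of "F - {p}" e] F by blast
      have "U \<inter> (if e p then snd p else fst p) \<noteq> {}"
        using p U(1) by (auto simp: splitting_pair_def)
      moreover have "U \<inter> (if e p then snd p else fst p) \<subseteq> G \<inter> (\<Inter>q\<in>F. if e q then snd q else fst q)"
        using U(2) by auto
      ultimately show "G \<inter> (\<Inter>q\<in>F. if e q then snd q else fst q) \<noteq> {}"
        by blast
    qed
    moreover have "splitting_pair X {} p"
      using p by (auto simp: splitting_pair_def)
    ultimately have "insert p P \<in> \<P>"
      using P(1) by (auto simp: \<P>_def)
    then have "p \<in> P"
      using P(2) by blast
    obtain U where "U \<in> \<A>" "U = G \<inter> snd p"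
      using meets[of "{p}" "\<lambda>_. True"] \<open>p \<in> P\<close> by auto
    then have "fst p \<inter> snd p \<noteq> {}"
      using p by (fastforce simp: splitting_pair_def)
    moreover have "fst p \<subseteq> X closure_of fst p" "snd p \<subseteq> X closure_of snd p"
      using splitting_pair_open(1,2)[OF p] by (simp_all add: closure_of_subset openin_subset)
    ultimately show False
      using splitting_pair_open(3)[OF p] unfolding disjnt_def by blast
  qed
  with P(1) show thesis
    by (intro that) (auto simp: \<P>_def)
qed

text \<open>
  Each coordinate of the cube needs countably many pairs, one for each binary digit; since \<open>I\<close> is
  infinite, \<open>I \<times> \<omega>\<close> still embeds into \<open>P\<close>.
\<close>

lemma independent_pairs_maps_onto_cube:
  fixes X :: "'a topology" and I :: "'i set"
  assumes X: "compact_space X" "normal_space X" and "openin X G"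
    and P: "independent_pairs G P" "\<And>p. p \<in> P \<Longrightarrow> splitting_pair X {} p"
    and I: "infinite I" "|I| \<le>o |P|"
  shows "\<exists>f. continuous_map X (product_topology (\<lambda>_. top_of_set {0..1::real}) I) f \<and>
    f ` topspace X = topspace (product_topology (\<lambda>_. top_of_set {0..1::real}) I)"
proof -
  have "|I \<times> (UNIV :: nat set)| \<le>o |I|"
    using I(1) by (intro card_of_Times_ordLeq_infinite_Field)
      (auto simp: Field_card_of card_of_card_order_on infinite_iff_card_of_nat[symmetric]
        intro: ordIso_imp_ordLeq card_of_refl)
  then have "|I \<times> (UNIV :: nat set)| \<le>o |P|"
    using I(2) by (rule ordLeq_transitive)
  then obtain g where g: "inj_on g (I \<times> (UNIV :: nat set))" "g ` (I \<times> UNIV) \<subseteq> P"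
    using card_of_ordLeq by metis
  define C where "C = (\<lambda>i n b. X closure_of (if b then snd (g (i, n)) else fst (g (i, n))))"
  show ?thesis
  proof (rule maps_onto_cube[OF X, of I C])
    fix i n assume "i \<in> I"
    then have "g (i, n) \<in> P"
      using g(2) by blast
    then show "disjnt (C i n False) (C i n True)"
      using P(2) by (auto simp: C_def splitting_pair_def)
  next
    fix F :: "('i \<times> nat) set" and e
    assume F: "finite F" "F \<subseteq> I \<times> UNIV"
    define e' :: "'a set \<times> 'a set \<Rightarrow> bool"
      where "e' p = (case inv_into (I \<times> UNIV) g p of (i, n) \<Rightarrow> e i n)" for p
    have e': "e' (g (i, n)) = e i n" if "(i, n) \<in> F" for i n
      using inv_into_f_f[OF g(1), of "(i, n)"] that F(2) by (auto simp: e'_def)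
    have "G \<inter> (\<Inter>p\<in>g ` F. if e' p then snd p else fst p) \<noteq> {}"
      using P(1) F g(2) unfolding independent_pairs_def by (meson finite_imageI image_mono order_trans)
    then obtain x where x: "x \<in> G" "\<And>p. p \<in> F \<Longrightarrow> x \<in> (if e' (g p) then snd (g p) else fst (g p))"
      by blast
    have "x \<in> topspace X"
      using x(1) \<open>openin X G\<close> openin_subset by blast
    moreover have "x \<in> C i n (e i n)" if "(i, n) \<in> F" for i n
    proof -
      have "g (i, n) \<in> P"
        using that F(2) g(2) by blast
      then have "openin X (if e i n then snd (g (i, n)) else fst (g (i, n)))"
        using P(2) splitting_pair_open by metis
      then have "(if e i n then snd (g (i, n)) else fst (g (i, n))) \<subseteq> C i n (e i n)"
        unfolding C_def by (intro closure_of_subset openin_subset)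
      then show ?thesis
        using x(2)[OF that] e'[OF that] by auto
    qed
    ultimately show "topspace X \<inter> (\<Inter>(i, n)\<in>F. C i n (e i n)) \<noteq> {}"
      by blast
  qed (simp add: C_def)
qed

section \<open>Small elementary families of open sets\<close>

definition diagonal_trace :: "'a topology \<Rightarrow> 'i set \<Rightarrow> ('i \<Rightarrow> 'a) set \<Rightarrow> 'a set" where
  "diagonal_trace X I V = {q \<in> topspace X. (\<lambda>i\<in>I. q) \<in> V}"

lemma openin_diagonal_trace:
  assumes "openin (product_topology (\<lambda>_. X) I) V"
  shows "openin X (diagonal_trace X I V)"
proof -
  have "continuous_map X (product_topology (\<lambda>_. X) I) (\<lambda>q. \<lambda>i\<in>I. q)"
    by (auto simp: continuous_map_componentwise)
  then show ?thesis
    unfolding diagonal_trace_def using assms by (rule openin_continuous_map_preimage)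
qed

lemma diagonal_trace_contains_cube:
  assumes "finite I" "openin (product_topology (\<lambda>_. X) I) V" "q \<in> diagonal_trace X I V"
  obtains N where "openin X N" "q \<in> N" "I \<rightarrow>\<^sub>E N \<subseteq> V"
proof -
  have q: "q \<in> topspace X" "(\<lambda>i\<in>I. q) \<in> V"
    using assms(3) by (auto simp: diagonal_trace_def)
  obtain S where S: "(\<lambda>i\<in>I. q) \<in> (\<Pi>\<^sub>E i\<in>I. S i)" "\<And>i. openin X (S i)" "(\<Pi>\<^sub>E i\<in>I. S i) \<subseteq> V"
    using product_topology_open_contains_basis[OF assms(2) q(2)] by auto
  show thesis
  proof (rule that)
    show "openin X (\<Inter>(insert (topspace X) (S ` I)))"
      using S(2) assms(1) by (intro openin_Inter) auto
    show "q \<in> \<Inter>(insert (topspace X) (S ` I))"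
      using q(1) S(1) by (auto simp: PiE_iff)
    have "I \<rightarrow>\<^sub>E \<Inter>(insert (topspace X) (S ` I)) \<subseteq> (\<Pi>\<^sub>E i\<in>I. S i)"
      by (rule PiE_mono) auto
    then show "I \<rightarrow>\<^sub>E \<Inter>(insert (topspace X) (S ` I)) \<subseteq> V"
      using S(3) by (rule order_trans)
  qed
qed

lemma openin_cube:
  assumes "finite I" "openin X U"
  shows "openin (product_topology (\<lambda>_. X) I) (I \<rightarrow>\<^sub>E U)"
  using assms by (simp add: openin_PiE)

text \<open>
  Some basic set lies below the cube, and every basic set above the cube is also above that one.
\<close>

lemma card_of_base_supersets_of_cube:
  assumes "finite I" "topology_base (product_topology (\<lambda>_. X) I) B" "op_like \<kappa> B"
    and U: "openin X U" "U \<noteq> {}"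
  shows "|{V \<in> B. I \<rightarrow>\<^sub>E U \<subseteq> V}| <o \<kappa>"
proof -
  obtain q where "q \<in> U"
    using U(2) by blast
  then have "(\<lambda>i\<in>I. q) \<in> I \<rightarrow>\<^sub>E U"
    by simp
  then obtain V0 where V0: "V0 \<in> B" "V0 \<subseteq> I \<rightarrow>\<^sub>E U"
    using assms(2) openin_cube[OF assms(1) U(1)] unfolding topology_base_def by metis
  have "|{V \<in> B. I \<rightarrow>\<^sub>E U \<subseteq> V}| \<le>o |{V \<in> B. V0 \<subseteq> V}|"
    using V0(2) by (intro card_of_mono1) blast
  also have "|{V \<in> B. V0 \<subseteq> V}| <o \<kappa>"
    using assms(3) V0(1) by (simp add: op_like_def)
  finally show ?thesis .
qed

lemma regular_space_closure_subset:
  assumes "regular_space X" "openin X U" "q \<in> U"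
  obtains T where "openin X T" "q \<in> T" "X closure_of T \<subseteq> U"
proof -
  have "neighbourhood_base_of (closedin X) X"
    using assms(1) by (simp add: neighbourhood_base_of_closedin)
  then have "\<forall>W x. openin X W \<and> x \<in> W \<longrightarrow>
      (\<exists>T C. openin X T \<and> closedin X C \<and> x \<in> T \<and> T \<subseteq> C \<and> C \<subseteq> W)"
    unfolding neighbourhood_base_of .
  then obtain T C where T: "openin X T" "q \<in> T" and C: "closedin X C" "T \<subseteq> C" "C \<subseteq> U"
    using assms(2,3) by metis
  have "X closure_of T \<subseteq> U"
    using closure_of_minimal[OF C(2,1)] C(3) by (rule order_trans)
  with T show thesis
    by (rule that)
qed

text \<open>
  The family \<open>\<A>\<close> plays the role of the open sets in an elementary submodel of size below \<open>\<kappa>\<close>. It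
  is closed under intersections, exteriors, shrinking, and a prescribed small-valued
  function \<open>a\<close>. The last clause is where the \<open>\<kappa>\<close>-op-like base \<open>B\<close> enters: the members of \<open>B\<close>
  that contain a cube over a member of \<open>\<A>\<close> are fewer than \<open>\<kappa>\<close>, so for any two of them with nested
  traces on the diagonal one can afford to put into \<open>\<A>\<close> a finite cover that witnesses the nesting.
\<close>

lemma ex_small_elementary_family:
  fixes X :: "'a topology" and \<kappa> :: "'k rel" and I :: "'i set"
  assumes X: "compact_space X" "regular_space X" "topspace X \<noteq> {}"
    and \<kappa>: "Card_order \<kappa>" "natLeq <o \<kappa>" "regularCard \<kappa>"
    and I: "finite I"
    and B: "topology_base (product_topology (\<lambda>_. X) I) B" "op_like \<kappa> B"
    and a: "\<And>U. |a U| <o \<kappa>" "\<And>U T. T \<in> a U \<Longrightarrow> openin X T \<and> T \<noteq> {}"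
  obtains \<A> where "|\<A>| <o \<kappa>" "topspace X \<in> \<A>" "\<And>U. U \<in> \<A> \<Longrightarrow> openin X U \<and> U \<noteq> {}"
    "\<And>U. U \<in> \<A> \<Longrightarrow> a U \<subseteq> \<A>"
    "\<And>U T. \<lbrakk>U \<in> \<A>; T \<in> \<A>; U \<inter> T \<noteq> {}\<rbrakk> \<Longrightarrow> U \<inter> T \<in> \<A>"
    "\<And>U. \<lbrakk>U \<in> \<A>; topspace X - X closure_of U \<noteq> {}\<rbrakk> \<Longrightarrow> topspace X - X closure_of U \<in> \<A>"
    "\<And>U. U \<in> \<A> \<Longrightarrow> \<exists>T\<in>\<A>. X closure_of T \<subseteq> U"
    "\<And>U\<^sub>1 U\<^sub>2 V\<^sub>1 V\<^sub>2 q. \<lbrakk>U\<^sub>1 \<in> \<A>; U\<^sub>2 \<in> \<A>; V\<^sub>1 \<in> B; V\<^sub>2 \<in> B; I \<rightarrow>\<^sub>E U\<^sub>1 \<subseteq> V\<^sub>1; I \<rightarrow>\<^sub>E U\<^sub>2 \<subseteq> V\<^sub>2;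
        X closure_of diagonal_trace X I V\<^sub>1 \<subseteq> diagonal_trace X I V\<^sub>2;
        q \<in> X closure_of diagonal_trace X I V\<^sub>1\<rbrakk> \<Longrightarrow> \<exists>T\<in>\<A>. q \<in> T \<and> I \<rightarrow>\<^sub>E T \<subseteq> V\<^sub>2"
proof -
  have inf: "cinfinite \<kappa>"
    using \<kappa>(1,2) by (rule cinfinite_if_natLeq_less)
  have "\<exists>T. openin X T \<and> T \<noteq> {} \<and> X closure_of T \<subseteq> U" if U: "openin X U" "U \<noteq> {}" for U
  proof -
    obtain q where "q \<in> U"
      using U(2) by blast
    then obtain T where "openin X T" "q \<in> T" "X closure_of T \<subseteq> U"
      using regular_space_closure_subset[OF X(2) U(1)] by blast
    then show ?thesis by blast
  qed
  then obtain s where s: "\<And>U. openin X U \<Longrightarrow> U \<noteq> {} \<Longrightarrow> openin X (s U) \<and> s U \<noteq> {} \<and> X closure_of (s U) \<subseteq> U"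
    by metis
  define fine_cover where "fine_cover V\<^sub>1 V\<^sub>2 \<C> \<longleftrightarrow> finite \<C> \<and> (\<forall>T\<in>\<C>. openin X T \<and> T \<noteq> {}) \<and>
      (V\<^sub>2 \<in> B \<and> X closure_of diagonal_trace X I V\<^sub>1 \<subseteq> diagonal_trace X I V\<^sub>2 \<longrightarrow>
        X closure_of diagonal_trace X I V\<^sub>1 \<subseteq> \<Union>\<C> \<and> (\<forall>T\<in>\<C>. I \<rightarrow>\<^sub>E T \<subseteq> V\<^sub>2))" for V\<^sub>1 V\<^sub>2 \<C>
  have "\<exists>\<C>. fine_cover V\<^sub>1 V\<^sub>2 \<C>" for V\<^sub>1 V\<^sub>2
  proof (cases "V\<^sub>2 \<in> B \<and> X closure_of diagonal_trace X I V\<^sub>1 \<subseteq> diagonal_trace X I V\<^sub>2")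
    case True
    then have open_V\<^sub>2: "openin (product_topology (\<lambda>_. X) I) V\<^sub>2"
      using B(1) by (simp add: topology_base_def)
    have "compactin X (X closure_of diagonal_trace X I V\<^sub>1)"
      using X(1) by (simp add: closedin_compact_space)
    moreover have "X closure_of diagonal_trace X I V\<^sub>1 \<subseteq> \<Union>{T. openin X T \<and> T \<noteq> {} \<and> I \<rightarrow>\<^sub>E T \<subseteq> V\<^sub>2}"
    proof
      fix q assume "q \<in> X closure_of diagonal_trace X I V\<^sub>1"
      then have "q \<in> diagonal_trace X I V\<^sub>2"
        using True by blast
      then show "q \<in> \<Union>{T. openin X T \<and> T \<noteq> {} \<and> I \<rightarrow>\<^sub>E T \<subseteq> V\<^sub>2}" (is ?thesis)
      proof (rule diagonal_trace_contains_cube[OF I open_V\<^sub>2])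
        fix N assume "openin X N" "q \<in> N" "I \<rightarrow>\<^sub>E N \<subseteq> V\<^sub>2"
        then show ?thesis by blast
      qed
    qed
    ultimately have "\<exists>\<C>. finite \<C> \<and> \<C> \<subseteq> {T. openin X T \<and> T \<noteq> {} \<and> I \<rightarrow>\<^sub>E T \<subseteq> V\<^sub>2} \<and>
        X closure_of diagonal_trace X I V\<^sub>1 \<subseteq> \<Union>\<C>"
      by (intro compactinD) auto
    then show ?thesis
      unfolding fine_cover_def by (elim ex_forward) blast
  qed (auto simp: fine_cover_def intro: exI[of _ "{}"])
  then obtain c where c: "\<And>V\<^sub>1 V\<^sub>2. fine_cover V\<^sub>1 V\<^sub>2 (c V\<^sub>1 V\<^sub>2)"
    by metis
  \<comment> \<open>The basic sets that are known to the family as soon as \<open>U\<close> belongs to it.\<close>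
  define h where "h U = (if openin X U \<and> U \<noteq> {} then {V \<in> B. I \<rightarrow>\<^sub>E U \<subseteq> V} else {})" for U
  define \<Phi> where "\<Phi> U T = {W \<in> {U \<inter> T, topspace X - X closure_of U, s U}. openin X W \<and> W \<noteq> {}} \<union>
    (a U \<union> (\<Union>V\<^sub>1\<in>h U. \<Union>V\<^sub>2\<in>h T. c V\<^sub>1 V\<^sub>2))" for U T
  have h_small: "|h U| <o \<kappa>" for U
    using card_of_base_supersets_of_cube[OF I B] \<kappa>(1) inf by (auto simp: h_def ordLess_finite)
  have c_small: "|c V\<^sub>1 V\<^sub>2| <o \<kappa>" for V\<^sub>1 V\<^sub>2
    using c[of V\<^sub>1 V\<^sub>2] \<kappa>(1) inf by (intro ordLess_finite) (simp_all add: fine_cover_def)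
  have "|\<Union>V\<^sub>2\<in>h T. c V\<^sub>1 V\<^sub>2| <o \<kappa>" for V\<^sub>1 T
    using \<kappa>(1,3) inf h_small c_small
    by (intro card_of_UNION_ordLess_infinite_Field_regularCard ballI) simp_all
  then have covers_small: "|\<Union>V\<^sub>1\<in>h U. \<Union>V\<^sub>2\<in>h T. c V\<^sub>1 V\<^sub>2| <o \<kappa>" for U T
    using \<kappa>(1,3) inf h_small c_small
    by (intro card_of_UNION_ordLess_infinite_Field_regularCard ballI) simp_all
  have \<Phi>_small: "|\<Phi> U T| <o \<kappa>" for U T
  proof -
    have "finite {W \<in> {U \<inter> T, topspace X - X closure_of U, s U}. openin X W \<and> W \<noteq> {}}"
      by simp
    then have "|{W \<in> {U \<inter> T, topspace X - X closure_of U, s U}. openin X W \<and> W \<noteq> {}}| <o \<kappa>"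
      using \<kappa>(1) inf by (rule ordLess_finite)
    moreover have "\<not> finite (Field \<kappa>)"
      using inf by (simp add: cinfinite_def)
    ultimately show ?thesis
      unfolding \<Phi>_def using a(1) \<kappa>(1) covers_small
      by (intro card_of_Un_ordLess_infinite_Field)
  qed
  obtain \<A> where \<A>: "topspace X \<in> \<A>" "|\<A>| <o \<kappa>" "\<And>U T. \<lbrakk>U \<in> \<A>; T \<in> \<A>\<rbrakk> \<Longrightarrow> \<Phi> U T \<subseteq> \<A>"
      "\<A> \<subseteq> insert (topspace X) (\<Union>U T. \<Phi> U T)"
    by (rule ex_small_closed_set[where \<Phi> = \<Phi> and a = "topspace X", OF \<kappa> \<Phi>_small]) (rule that)
  have c_open: "openin X W \<and> W \<noteq> {}" if "W \<in> c V\<^sub>1 V\<^sub>2" for W V\<^sub>1 V\<^sub>2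
    using c[of V\<^sub>1 V\<^sub>2] that by (simp add: fine_cover_def)
  have open_\<Phi>: "openin X W \<and> W \<noteq> {}" if "W \<in> \<Phi> U T" for U T W
    using that unfolding \<Phi>_def by (elim UnE UN_E) (rule a(2) c_open, assumption | simp)+
  have open_\<A>: "openin X U \<and> U \<noteq> {}" if "U \<in> \<A>" for U
    using \<A>(4) that X(3) open_\<Phi> by blast
  have basic: "W \<in> \<A>"
    if "U \<in> \<A>" "T \<in> \<A>" "W \<in> {U \<inter> T, topspace X - X closure_of U, s U}" "openin X W" "W \<noteq> {}" for U T W
    using \<A>(3)[OF that(1,2)] by (rule subsetD) (use that(3-5) in \<open>simp add: \<Phi>_def\<close>)
  show thesis
  proof (rule that)
    fix U assume U: "U \<in> \<A>"
    show "a U \<subseteq> \<A>"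
      using \<A>(3)[OF U U] by (simp add: \<Phi>_def)
    show "\<exists>T\<in>\<A>. X closure_of T \<subseteq> U"
      using basic[OF U U, of "s U"] s[of U] open_\<A>[OF U] by auto
    show "topspace X - X closure_of U \<in> \<A>" if "topspace X - X closure_of U \<noteq> {}"
      using basic[OF U U, of "topspace X - X closure_of U"] that by (simp add: openin_diff)
    show "U \<inter> T \<in> \<A>" if "T \<in> \<A>" "U \<inter> T \<noteq> {}" for T
      using basic[OF U that(1), of "U \<inter> T"] open_\<A> U that by (simp add: openin_Int)
  next
    fix U\<^sub>1 U\<^sub>2 V\<^sub>1 V\<^sub>2 q
    assume U: "U\<^sub>1 \<in> \<A>" "U\<^sub>2 \<in> \<A>" and V: "V\<^sub>1 \<in> B" "V\<^sub>2 \<in> B" "I \<rightarrow>\<^sub>E U\<^sub>1 \<subseteq> V\<^sub>1" "I \<rightarrow>\<^sub>E U\<^sub>2 \<subseteq> V\<^sub>2"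
        "X closure_of diagonal_trace X I V\<^sub>1 \<subseteq> diagonal_trace X I V\<^sub>2"
      and q: "q \<in> X closure_of diagonal_trace X I V\<^sub>1"
    have "X closure_of diagonal_trace X I V\<^sub>1 \<subseteq> \<Union>(c V\<^sub>1 V\<^sub>2) \<and> (\<forall>T\<in>c V\<^sub>1 V\<^sub>2. I \<rightarrow>\<^sub>E T \<subseteq> V\<^sub>2)"
      using c[of V\<^sub>1 V\<^sub>2] V(2,5) by (simp add: fine_cover_def)
    then obtain T where T: "T \<in> c V\<^sub>1 V\<^sub>2" "q \<in> T" "I \<rightarrow>\<^sub>E T \<subseteq> V\<^sub>2"
      using q by blast
    have "V\<^sub>1 \<in> h U\<^sub>1" "V\<^sub>2 \<in> h U\<^sub>2"
      using U V open_\<A> by (simp_all add: h_def)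
    then have "T \<in> \<Phi> U\<^sub>1 U\<^sub>2"
      unfolding \<Phi>_def using T(1) by (intro UnI2 UN_I)
    then show "\<exists>T\<in>\<A>. q \<in> T \<and> I \<rightarrow>\<^sub>E T \<subseteq> V\<^sub>2"
      using \<A>(3)[OF U] T by blast
  qed (use \<A> open_\<A> in simp_all)
qed

section \<open>Splitting pairs from an op-like base of a power\<close>

definition local_base_at :: "'a topology \<Rightarrow> 'a set set \<Rightarrow> 'a \<Rightarrow> bool" where
  "local_base_at X \<A> q \<longleftrightarrow> (\<forall>W. openin X W \<and> q \<in> W \<longrightarrow> (\<exists>U\<in>\<A>. q \<in> U \<and> U \<subseteq> W))"

text \<open>
  If every neighbourhood of \<open>q\<close> contains a member of \<open>\<A>\<close>, then every basic neighbourhood of the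
  diagonal point \<open>(q, \<dots>, q)\<close> contains the cube over a member of \<open>\<A>\<close>. So any two of these basic
  neighbourhoods are subject to the covering clause; applied to two of them with nested traces inside
  a given neighbourhood of \<open>q\<close>, it yields a member of \<open>\<A>\<close> that contains \<open>q\<close> itself. Only diagonal
  points are considered, which is why an op-like base of a power is as good as one of \<open>X\<close>.
\<close>

lemma local_pi_base_imp_local_base:
  fixes X :: "'a topology" and I :: "'i set"
  assumes "regular_space X" and I: "finite I" "I \<noteq> {}"
    and B: "topology_base (product_topology (\<lambda>_. X) I) B"
    and covers: "\<And>U\<^sub>1 U\<^sub>2 V\<^sub>1 V\<^sub>2 q. \<lbrakk>U\<^sub>1 \<in> \<A>; U\<^sub>2 \<in> \<A>; V\<^sub>1 \<in> B; V\<^sub>2 \<in> B; I \<rightarrow>\<^sub>E U\<^sub>1 \<subseteq> V\<^sub>1; I \<rightarrow>\<^sub>E U\<^sub>2 \<subseteq> V\<^sub>2;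
        X closure_of diagonal_trace X I V\<^sub>1 \<subseteq> diagonal_trace X I V\<^sub>2;
        q \<in> X closure_of diagonal_trace X I V\<^sub>1\<rbrakk> \<Longrightarrow> \<exists>T\<in>\<A>. q \<in> T \<and> I \<rightarrow>\<^sub>E T \<subseteq> V\<^sub>2"
    and pi_base: "\<And>W. openin X W \<Longrightarrow> q \<in> W \<Longrightarrow> \<exists>U\<in>\<A>. U \<subseteq> W"
    and q: "q \<in> topspace X"
  shows "local_base_at X \<A> q"
  unfolding local_base_at_def
proof (intro allI impI, elim conjE)
  fix W assume W: "openin X W" "q \<in> W"
  have point: "x \<in> U" if "(\<lambda>i\<in>I. x) \<in> I \<rightarrow>\<^sub>E U" for x U
    using that I(2) by (auto simp: PiE_iff)
  have ex_B: "\<exists>V\<in>B. (\<lambda>i\<in>I. q) \<in> V \<and> V \<subseteq> I \<rightarrow>\<^sub>E N" if N: "openin X N" "q \<in> N" for N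
  proof -
    have "(\<lambda>i\<in>I. q) \<in> I \<rightarrow>\<^sub>E N"
      using N(2) by simp
    then show ?thesis
      using B openin_cube[OF I(1) N(1)] unfolding topology_base_def by simp
  qed
  have ex_\<A>: "\<exists>U\<in>\<A>. I \<rightarrow>\<^sub>E U \<subseteq> V" if V: "V \<in> B" "(\<lambda>i\<in>I. q) \<in> V" for V
  proof -
    have "openin (product_topology (\<lambda>_. X) I) V" "q \<in> diagonal_trace X I V"
      using B V q by (auto simp: topology_base_def diagonal_trace_def)
    then obtain N where N: "openin X N" "q \<in> N" "I \<rightarrow>\<^sub>E N \<subseteq> V"
      by (rule diagonal_trace_contains_cube[OF I(1)])
    then obtain U where U: "U \<in> \<A>" "U \<subseteq> N"
      using pi_base by blast
    have "I \<rightarrow>\<^sub>E U \<subseteq> I \<rightarrow>\<^sub>E N"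
      using U(2) by (intro PiE_mono)
    with U(1) N(3) show ?thesis by blast
  qed
  obtain V\<^sub>2 where V\<^sub>2: "V\<^sub>2 \<in> B" "(\<lambda>i\<in>I. q) \<in> V\<^sub>2" "V\<^sub>2 \<subseteq> I \<rightarrow>\<^sub>E W"
    using ex_B[OF W] by blast
  have "openin X (diagonal_trace X I V\<^sub>2)"
    using B V\<^sub>2(1) by (intro openin_diagonal_trace) (simp add: topology_base_def)
  moreover have "q \<in> diagonal_trace X I V\<^sub>2"
    using V\<^sub>2(2) q by (simp add: diagonal_trace_def)
  ultimately obtain N where N: "openin X N" "q \<in> N" "X closure_of N \<subseteq> diagonal_trace X I V\<^sub>2"
    by (rule regular_space_closure_subset[OF assms(1)])
  obtain V\<^sub>1 where V\<^sub>1: "V\<^sub>1 \<in> B" "(\<lambda>i\<in>I. q) \<in> V\<^sub>1" "V\<^sub>1 \<subseteq> I \<rightarrow>\<^sub>E N"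
    using ex_B[OF N(1,2)] by blast
  have "diagonal_trace X I V\<^sub>1 \<subseteq> N"
    using V\<^sub>1(3) unfolding diagonal_trace_def by (intro subsetI point[of _ N]) blast
  then have nested: "X closure_of diagonal_trace X I V\<^sub>1 \<subseteq> diagonal_trace X I V\<^sub>2"
    by (rule order_trans[OF closure_of_mono N(3)])
  have "q \<in> diagonal_trace X I V\<^sub>1"
    using V\<^sub>1(2) q by (simp add: diagonal_trace_def)
  moreover have "diagonal_trace X I V\<^sub>1 \<subseteq> X closure_of diagonal_trace X I V\<^sub>1"
    by (rule closure_of_subset) (auto simp: diagonal_trace_def)
  ultimately have q_closure: "q \<in> X closure_of diagonal_trace X I V\<^sub>1"
    by blast
  obtain U\<^sub>1 where U\<^sub>1: "U\<^sub>1 \<in> \<A>" "I \<rightarrow>\<^sub>E U\<^sub>1 \<subseteq> V\<^sub>1"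
    using ex_\<A>[OF V\<^sub>1(1,2)] by blast
  obtain U\<^sub>2 where U\<^sub>2: "U\<^sub>2 \<in> \<A>" "I \<rightarrow>\<^sub>E U\<^sub>2 \<subseteq> V\<^sub>2"
    using ex_\<A>[OF V\<^sub>2(1,2)] by blast
  obtain T where T: "T \<in> \<A>" "q \<in> T" "I \<rightarrow>\<^sub>E T \<subseteq> V\<^sub>2"
    using covers[OF U\<^sub>1(1) U\<^sub>2(1) V\<^sub>1(1) V\<^sub>2(1) U\<^sub>1(2) U\<^sub>2(2) nested q_closure] by blast
  have "T \<subseteq> W"
  proof
    fix t assume "t \<in> T"
    then have "(\<lambda>i\<in>I. t) \<in> I \<rightarrow>\<^sub>E T"
      by simp
    then show "t \<in> W"
      using T(3) V\<^sub>2(3) by (intro point[of t W]) (rule subsetD, assumption, rule subsetD)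
  qed
  with T(1,2) show "\<exists>U\<in>\<A>. q \<in> U \<and> U \<subseteq> W"
    by (intro bexI[of _ T] conjI)
qed

text \<open>
  Drop members of the cover one at a time, shrinking \<open>G\<close> whenever the remaining ones still contain a
  member of \<open>\<A>\<close>. At the first step where they do not, the remaining union \<open>M\<close> and the dropped set
  \<open>N\<close> are as required.
\<close>

lemma reduce_cover_to_two:
  assumes \<A>: "{} \<notin> \<A>" "\<And>U. U \<in> \<A> \<Longrightarrow> openin X U" "\<And>U. U \<in> \<A> \<Longrightarrow> \<exists>T\<in>\<A>. X closure_of T \<subseteq> U"
    and "finite \<N>" "\<And>N. N \<in> \<N> \<Longrightarrow> openin X N" "\<And>N U. N \<in> \<N> \<Longrightarrow> U \<in> \<A> \<Longrightarrow> \<not> U \<subseteq> N"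
    and "G \<in> \<A>" "X closure_of G \<subseteq> \<Union>\<N>"
  shows "\<exists>H\<in>\<A>. \<exists>M N. openin X M \<and> openin X N \<and> X closure_of H \<subseteq> M \<union> N \<and>
    (\<forall>U\<in>\<A>. \<not> U \<subseteq> M \<and> \<not> U \<subseteq> N)"
  using assms(4-8)
proof (induction \<N> arbitrary: G)
  case empty
  have "G \<subseteq> X closure_of G"
    using empty \<A>(2) by (intro closure_of_subset openin_subset)
  then have "G = {}"
    using empty by auto
  then show ?case
    using empty \<A>(1) by simp
next
  case (insert N \<N>)
  show ?case
  proof (cases "\<exists>U\<in>\<A>. U \<subseteq> \<Union>\<N>")
    case True
    then obtain T where "T \<in> \<A>" "X closure_of T \<subseteq> \<Union>\<N>"
      using \<A>(3) by (meson order_trans)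
    then show ?thesis
      using insert.prems by (intro insert.IH[of T]) auto
  next
    case False
    then have "openin X (\<Union>\<N>)" "\<forall>U\<in>\<A>. \<not> U \<subseteq> \<Union>\<N> \<and> \<not> U \<subseteq> N"
      using insert.prems by auto
    moreover have "openin X N" "X closure_of G \<subseteq> \<Union>\<N> \<union> N"
      using insert.prems by auto
    ultimately show ?thesis
      using insert.prems(3) by (intro bexI[of _ G] exI conjI)
  qed
qed

text \<open>
  The closed sets \<open>X closure_of H - M\<close> and \<open>X closure_of H - N\<close> are disjoint because \<open>M\<close> and \<open>N\<close>
  cover, and each meets every \<open>U\<close> in \<open>\<A>\<close> because neither \<open>M\<close> nor \<open>N\<close> contains \<open>U\<close>. Normality
  turns them into open sets with disjoint closures.
\<close>

lemma ex_splitting_pair: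
  assumes "normal_space X" and MN: "openin X M" "openin X N" "X closure_of H \<subseteq> M \<union> N"
    and H: "H \<subseteq> topspace X" and \<A>: "\<And>U. U \<in> \<A> \<Longrightarrow> U \<subseteq> H \<and> \<not> U \<subseteq> M \<and> \<not> U \<subseteq> N"
  shows "\<exists>p. splitting_pair X \<A> p"
proof -
  have "closedin X (X closure_of H - M)" "closedin X (X closure_of H - N)"
    using MN(1,2) by (auto intro: closedin_diff)
  moreover have "disjnt (X closure_of H - M) (X closure_of H - N)"
    using MN(3) by (auto simp: disjnt_def)
  ultimately obtain V where V: "openin X V" "X closure_of H - M \<subseteq> V" "disjnt (X closure_of H - N) (X closure_of V)"
    using assms(1) unfolding normal_space by metis
  from V(3) obtain W where W: "openin X W" "X closure_of H - N \<subseteq> W" "disjnt (X closure_of V) (X closure_of W)"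
    using assms(1) \<open>closedin X (X closure_of H - N)\<close> unfolding normal_space by (metis closedin_closure_of)
  have "U \<inter> V \<noteq> {} \<and> U \<inter> W \<noteq> {}" if "U \<in> \<A>" for U
    using \<A>[OF that] V(2) W(2) closure_of_subset[OF H] by blast
  then have "splitting_pair X \<A> (V, W)"
    using V W by (simp add: splitting_pair_def)
  then show ?thesis by blast
qed

text \<open>
  This takes the place of a pressing-down argument. If every open \<open>G\<close> had a small family \<open>a G\<close> below
  it without a splitting pair, take a small elementary family \<open>\<A>\<close> closed under \<open>a\<close>. It is too
  small to be a base, so it fails to be a local base at some \<open>p\<close>. Let \<open>F\<close> be the set of points that
  \<open>\<A>\<close> does not separate from \<open>p\<close>. At no point of \<open>F\<close> is \<open>\<A>\<close> a local base, so every
  point of \<open>F\<close> has a neighbourhood that contains no member of \<open>\<A>\<close> at all. Finitely many of these cover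
  \<open>F\<close>, hence also the closure of some \<open>G\<close> in \<open>\<A>\<close>, and the two lemmas above give some \<open>H\<close> in
  \<open>\<A>\<close> together with a pair that splits all members of \<open>\<A>\<close> below \<open>H\<close>. Since \<open>a H\<close> is
  part of \<open>\<A>\<close>, this is a contradiction.
\<close>

lemma ex_open_set_split_everywhere:
  fixes X :: "'a topology" and \<kappa> :: "'k rel" and I :: "'i set"
  assumes X: "compact_space X" "Hausdorff_space X" "topspace X \<noteq> {}"
    and \<kappa>: "Card_order \<kappa>" "natLeq <o \<kappa>" "regularCard \<kappa>" "\<kappa> \<le>o weight X"
    and I: "finite I" "I \<noteq> {}"
    and B: "topology_base (product_topology (\<lambda>_. X) I) B" "op_like \<kappa> B"
  shows "\<exists>G. openin X G \<and> G \<noteq> {} \<and> (\<forall>\<A>. |\<A>| <o \<kappa> \<and> (\<forall>U\<in>\<A>. openin X U \<and> U \<noteq> {} \<and> U \<subseteq> G) \<longrightarrow>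
    (\<exists>p. splitting_pair X \<A> p))"
proof (rule ccontr)
  assume no_G: "\<not> ?thesis"
  have reg: "regular_space X" and norm: "normal_space X"
    using X compact_Hausdorff_imp_regular_space compact_Hausdorff_or_regular_imp_normal_space by blast+
  define bad where "bad G \<A> \<longleftrightarrow> |\<A>| <o \<kappa> \<and> (\<forall>U\<in>\<A>. openin X U \<and> U \<noteq> {} \<and> U \<subseteq> G) \<and>
    (\<forall>p. \<not> splitting_pair X \<A> p)" for G \<A>
  have "\<exists>\<A>. bad G \<A>" if "openin X G" "G \<noteq> {}" for G
    using no_G that unfolding bad_def by metis
  then obtain b where b: "\<And>G. openin X G \<Longrightarrow> G \<noteq> {} \<Longrightarrow> bad G (b G)"
    by metis
  define a where "a G = (if openin X G \<and> G \<noteq> {} then b G else {})" for G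
  have inf: "cinfinite \<kappa>"
    using \<kappa>(1,2) by (rule cinfinite_if_natLeq_less)
  have a_small: "|a G| <o \<kappa>" for G
    using b[of G] ordLess_finite[of "{} :: 'a set set", OF finite.emptyI \<kappa>(1) inf] by (simp add: a_def bad_def)
  have a_open: "openin X T \<and> T \<noteq> {}" if "T \<in> a G" for G T
    using b[of G] that by (auto simp: a_def bad_def split: if_splits)
  obtain \<A> where small: "|\<A>| <o \<kappa>" and top: "topspace X \<in> \<A>"
    and \<A>: "\<And>U. U \<in> \<A> \<Longrightarrow> openin X U \<and> U \<noteq> {}"
    and a_\<A>: "\<And>U. U \<in> \<A> \<Longrightarrow> a U \<subseteq> \<A>"
    and inter: "\<And>U T. \<lbrakk>U \<in> \<A>; T \<in> \<A>; U \<inter> T \<noteq> {}\<rbrakk> \<Longrightarrow> U \<inter> T \<in> \<A>"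
    and compl: "\<And>U. \<lbrakk>U \<in> \<A>; topspace X - X closure_of U \<noteq> {}\<rbrakk> \<Longrightarrow> topspace X - X closure_of U \<in> \<A>"
    and shrink: "\<And>U. U \<in> \<A> \<Longrightarrow> \<exists>T\<in>\<A>. X closure_of T \<subseteq> U"
    and covers: "\<And>U\<^sub>1 U\<^sub>2 V\<^sub>1 V\<^sub>2 q. \<lbrakk>U\<^sub>1 \<in> \<A>; U\<^sub>2 \<in> \<A>; V\<^sub>1 \<in> B; V\<^sub>2 \<in> B; I \<rightarrow>\<^sub>E U\<^sub>1 \<subseteq> V\<^sub>1; I \<rightarrow>\<^sub>E U\<^sub>2 \<subseteq> V\<^sub>2;
        X closure_of diagonal_trace X I V\<^sub>1 \<subseteq> diagonal_trace X I V\<^sub>2;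
        q \<in> X closure_of diagonal_trace X I V\<^sub>1\<rbrakk> \<Longrightarrow> \<exists>T\<in>\<A>. q \<in> T \<and> I \<rightarrow>\<^sub>E T \<subseteq> V\<^sub>2"
    by (rule ex_small_elementary_family[where a = a, OF X(1) reg X(3) \<kappa>(1-3) I(1) B a_small a_open]) (assumption, rule that)
  have "\<exists>p\<in>topspace X. \<not> local_base_at X \<A> p"
  proof (rule ccontr)
    assume "\<not> ?thesis"
    then have "topology_base X \<A>"
      using \<A> openin_subset unfolding topology_base_def local_base_at_def by blast
    then have "weight X \<le>o |\<A>|"
      by (rule weight_least)
    then show False
      using small \<kappa>(4) by (meson not_ordLess_ordLeq ordLess_ordLeq_trans)
  qed
  then obtain p where p: "p \<in> topspace X" "\<not> local_base_at X \<A> p"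
    by blast
  define F where "F = \<Inter>((closure_of) X ` {U \<in> \<A>. p \<in> U})"
  have "closedin X F"
    unfolding F_def using p(1) top by (intro closedin_Inter) auto
  have not_base: "\<not> local_base_at X \<A> q" if q: "q \<in> F" for q
  proof
    assume base: "local_base_at X \<A> q"
    have "q \<in> topspace X"
      using q \<open>closedin X F\<close> closedin_subset by blast
    have "q \<noteq> p"
      using base p(2) by blast
    have "openin X (topspace X - {p})"
      using X(2) p(1) by (simp add: closedin_Hausdorff_singleton openin_diff)
    moreover have "q \<in> topspace X - {p}"
      using \<open>q \<in> topspace X\<close> \<open>q \<noteq> p\<close> by simp
    ultimately obtain U where U: "U \<in> \<A>" "q \<in> U" "U \<subseteq> topspace X - {p}"
      using base unfolding local_base_at_def by metis
    \<comment> \<open>\<open>\<A>\<close> separates \<open>q\<close> from \<open>p\<close> by some \<open>T\<close> and its exterior, contrary to \<open>q \<in> F\<close>.\<close>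
    obtain N where "openin X N" "q \<in> N" "X closure_of N \<subseteq> U"
      using \<A>[OF U(1)] U(2) by (auto intro: regular_space_closure_subset[OF reg])
    then obtain T where T: "T \<in> \<A>" "q \<in> T" "T \<subseteq> N"
      using base unfolding local_base_at_def by blast
    have "p \<in> topspace X - X closure_of T"
      using p(1) U(3) \<open>X closure_of N \<subseteq> U\<close> closure_of_mono[OF T(3), of X] by blast
    moreover from this have "topspace X - X closure_of T \<in> \<A>"
      using compl[OF T(1)] by blast
    ultimately have "q \<in> X closure_of (topspace X - X closure_of T)"
      using q unfolding F_def by blast
    then have "T \<inter> (topspace X - X closure_of T) \<noteq> {}"
      using \<A>[OF T(1)] T(2) unfolding in_closure_of by blast
    moreover have "T \<subseteq> X closure_of T"
      using \<A>[OF T(1)] by (intro closure_of_subset openin_subset) simp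
    ultimately show False by blast
  qed
  define \<O> where "\<O> = {N. openin X N \<and> (\<forall>U\<in>\<A>. \<not> U \<subseteq> N)}"
  have "F \<subseteq> \<Union>\<O>"
  proof
    fix q assume "q \<in> F"
    then have "q \<in> topspace X"
      using \<open>closedin X F\<close> closedin_subset by blast
    show "q \<in> \<Union>\<O>"
    proof (rule ccontr)
      assume "q \<notin> \<Union>\<O>"
      then have pi_base: "\<exists>U\<in>\<A>. U \<subseteq> W" if "openin X W" "q \<in> W" for W
        using that unfolding \<O>_def by blast
      have "local_base_at X \<A> q"
        by (rule local_pi_base_imp_local_base[OF reg I B(1)])
          (rule covers pi_base \<open>q \<in> topspace X\<close>; assumption)+
      then show False
        using not_base[OF \<open>q \<in> F\<close>] by simp
    qed
  qed
  moreover have "compactin X F"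
    using X(1) \<open>closedin X F\<close> by (rule closedin_compact_space)
  ultimately obtain \<N> where \<N>: "finite \<N>" "\<N> \<subseteq> \<O>" "F \<subseteq> \<Union>\<N>"
    using compactinD[of X F \<O>] unfolding \<O>_def by auto
  have inters: "topspace X \<inter> \<Inter>\<U> \<in> \<A>" if "finite \<U>" "\<U> \<subseteq> {U \<in> \<A>. p \<in> U}" for \<U>
    using that
  proof (induction \<U>)
    case (insert U \<U>)
    have "U \<inter> (topspace X \<inter> \<Inter>\<U>) \<in> \<A>"
    proof (rule inter)
      show "U \<inter> (topspace X \<inter> \<Inter>\<U>) \<noteq> {}"
        using insert.prems p(1) by blast
    qed (use insert in auto)
    then show ?case
      by (simp add: Int_left_commute)
  qed (simp add: top)
  have "openin X (\<Union>\<N>)"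
    using \<N>(2) unfolding \<O>_def by blast
  then have rest_compact: "compactin X (topspace X - \<Union>\<N>)"
    using X(1) by (intro closedin_compact_space) auto
  have rest_covered: "topspace X - \<Union>\<N> \<subseteq> \<Union>((\<lambda>U. topspace X - X closure_of U) ` {U \<in> \<A>. p \<in> U})"
  proof
    fix x assume x: "x \<in> topspace X - \<Union>\<N>"
    then have "x \<notin> F"
      using \<N>(3) by blast
    then obtain U where "U \<in> {U \<in> \<A>. p \<in> U}" "x \<notin> X closure_of U"
      unfolding F_def by auto
    then show "x \<in> \<Union>((\<lambda>U. topspace X - X closure_of U) ` {U \<in> \<A>. p \<in> U})"
      using x by (intro UN_I[of U]) simp_all
  qed
  have "\<exists>\<F>. finite \<F> \<and> \<F> \<subseteq> (\<lambda>U. topspace X - X closure_of U) ` {U \<in> \<A>. p \<in> U} \<and> topspace X - \<Union>\<N> \<subseteq> \<Union>\<F>"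
    by (rule compactinD[OF rest_compact _ rest_covered]) (auto intro: openin_diff)
  then obtain \<F> where \<F>: "finite \<F>" "\<F> \<subseteq> (\<lambda>U. topspace X - X closure_of U) ` {U \<in> \<A>. p \<in> U}"
      "topspace X - \<Union>\<N> \<subseteq> \<Union>\<F>"
    by blast
  from finite_subset_image[OF \<F>(1,2)] \<F>(3) obtain \<U> where \<U>: "finite \<U>" "\<U> \<subseteq> {U \<in> \<A>. p \<in> U}"
      "topspace X - \<Union>\<N> \<subseteq> \<Union>((\<lambda>U. topspace X - X closure_of U) ` \<U>)"
    by blast
  define G where "G = topspace X \<inter> \<Inter>\<U>"
  have "G \<in> \<A>"
    unfolding G_def using \<U>(1,2) by (rule inters)
  have G_closure: "X closure_of G \<subseteq> X closure_of U" if "U \<in> \<U>" for U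
    using that unfolding G_def by (intro closure_of_mono) blast
  have "X closure_of G \<subseteq> \<Union>\<N>"
  proof (rule ccontr)
    assume "\<not> ?thesis"
    then obtain x where x: "x \<in> X closure_of G" "x \<in> topspace X - \<Union>\<N>"
      using closure_of_subset_topspace[of X G] by blast
    then obtain U where "U \<in> \<U>" "x \<notin> X closure_of U"
      using \<U>(3) by blast
    then show False
      using G_closure x(1) by blast
  qed
  moreover have "{} \<notin> \<A>"
    using \<A> by blast
  ultimately have "\<exists>H\<in>\<A>. \<exists>M N. openin X M \<and> openin X N \<and> X closure_of H \<subseteq> M \<union> N \<and>
      (\<forall>U\<in>\<A>. \<not> U \<subseteq> M \<and> \<not> U \<subseteq> N)"
    using \<A> shrink \<N>(1,2) \<open>G \<in> \<A>\<close>
    by (intro reduce_cover_to_two[of \<A> X \<N> G]) (auto simp: \<O>_def)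
  then obtain H M N where H: "H \<in> \<A>" and MN: "openin X M" "openin X N" "X closure_of H \<subseteq> M \<union> N"
      "\<forall>U\<in>\<A>. \<not> U \<subseteq> M \<and> \<not> U \<subseteq> N"
    by blast
  have "bad H (a H)"
    using b[of H] \<A>[OF H] by (simp add: a_def)
  then have "\<forall>p. \<not> splitting_pair X (a H) p" and below_H: "\<forall>U\<in>a H. U \<subseteq> H"
    by (simp_all add: bad_def)
  moreover have "\<exists>p. splitting_pair X (a H) p"
    using norm MN(1-3)
  proof (rule ex_splitting_pair)
    show "H \<subseteq> topspace X"
      using \<A>[OF H] by (simp add: openin_subset)
    show "U \<subseteq> H \<and> \<not> U \<subseteq> M \<and> \<not> U \<subseteq> N" if "U \<in> a H" for U
    proof -
      have "U \<in> \<A>"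
        using a_\<A>[OF H] that by (rule subsetD)
      then show ?thesis
        using below_H MN(4) that by simp
    qed
  qed
  ultimately show False
    by blast
qed

section \<open>Countable weight\<close>

lemma topology_base_empty:
  assumes "topspace X = {}"
  shows "topology_base X {}"
  unfolding topology_base_def using assms openin_subset by fastforce

text \<open>
  Take finite covers \<open>\<C> k\<close> of \<open>X\<close> that become finer and finer: a member of \<open>\<C> k\<close> that meets
  \<open>P m\<close> for some \<open>m < k\<close> lies in \<open>R m\<close>, where the pairs \<open>P m\<close>, \<open>R m\<close> enumerate all
  pairs of members of \<open>E\<close> such that the closure of the first is contained in the second.
  Given a basic set \<open>U\<close>, choose \<open>x\<close> in it and a neighbourhood \<open>W\<close> of \<open>x\<close> such that at most \<open>U\<close>
  itself lies between \<open>U\<close> and \<open>W\<close>. From some \<open>k\<close> on, the members of \<open>\<C> k\<close> that contain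
  \<open>x\<close> lie in \<open>W\<close>, so apart from \<open>U\<close> only the finitely many members of the earlier covers can
  contain \<open>U\<close>.
\<close>

lemma second_countable_compact_base:
  assumes X: "compact_space X" "Hausdorff_space X" and E: "topology_base X E" "countable E"
  obtains B where "topology_base X B" "\<And>U. U \<in> B \<Longrightarrow> finite {V \<in> B. U \<subseteq> V}"
proof (cases "topspace X = {}")
  case True
  then have "topology_base X {}"
    by (rule topology_base_empty)
  then show thesis
    by (intro that[of "{}"]) auto
next
  case False
  have reg: "regular_space X"
    using X by (intro compact_Hausdorff_imp_regular_space) auto
  define Q where "Q = {(P, R) \<in> E \<times> E. X closure_of P \<subseteq> R}"
  have ex_Q: "\<exists>(P, R)\<in>Q. x \<in> P \<and> R \<subseteq> W" if W: "openin X W" "x \<in> W" for W x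
  proof -
    obtain R where R: "R \<in> E" "x \<in> R" "R \<subseteq> W"
      using E(1) W unfolding topology_base_def by metis
    then have "openin X R"
      using E(1) by (simp add: topology_base_def)
    then obtain N where N: "openin X N" "x \<in> N" "X closure_of N \<subseteq> R"
      using R(2) by (rule regular_space_closure_subset[OF reg])
    then obtain P where P: "P \<in> E" "x \<in> P" "P \<subseteq> N"
      using E(1) unfolding topology_base_def by metis
    have "X closure_of P \<subseteq> R"
      by (rule order_trans[OF closure_of_mono[OF P(3)] N(3)])
    then show ?thesis
      using P R by (intro bexI[of _ "(P, R)"]) (auto simp: Q_def)
  qed
  have "Q \<noteq> {}"
    using ex_Q[OF openin_topspace] False by blast
  moreover have "countable Q"
    using E(2) by (intro countable_subset[of Q "E \<times> E"] countable_SIGMA) (auto simp: Q_def)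
  moreover define e where "e = from_nat_into Q"
  ultimately have e: "range e = Q"
    by (simp add: range_from_nat_into)
  define P R where "P m = fst (e m)" and "R m = snd (e m)" for m
  have PR: "openin X (P m)" "openin X (R m)" "X closure_of P m \<subseteq> R m" for m
  proof -
    have "(P m, R m) \<in> Q"
      using e by (auto simp: P_def R_def)
    then show "openin X (P m)" "openin X (R m)" "X closure_of P m \<subseteq> R m"
      using E(1) by (auto simp: Q_def topology_base_def)
  qed
  have ex_m: "\<exists>m. x \<in> P m \<and> R m \<subseteq> W" if W: "openin X W" "x \<in> W" for W x
  proof -
    obtain q where "q \<in> Q" "x \<in> fst q" "snd q \<subseteq> W"
      using ex_Q[OF W] by auto
    moreover obtain m where "q = e m"
      using e \<open>q \<in> Q\<close> by blast
    ultimately show ?thesis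
      by (auto simp: P_def R_def)
  qed
  define S where "S k x = \<Inter>(insert (topspace X)
    ((\<lambda>m. if x \<in> X closure_of P m then R m else topspace X - X closure_of P m) ` {..<k}))" for k :: nat and x
  have S_open: "openin X (S k x)" for k x
    unfolding S_def using PR(2) by (intro openin_Inter) (auto intro: openin_diff)
  have S_self: "x \<in> S k x" if "x \<in> topspace X" for k x
    using that PR(3) by (auto simp: S_def)
  have S_fine: "S k x \<subseteq> R m" if "m < k" "z \<in> S k x" "z \<in> P m" for k x m z
  proof -
    have le: "S k x \<subseteq> (if x \<in> X closure_of P m then R m else topspace X - X closure_of P m)"
      unfolding S_def using that(1) by auto
    have "P m \<subseteq> X closure_of P m"
      using PR(1) by (intro closure_of_subset openin_subset)
    then have "x \<in> X closure_of P m"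
      using le that(2,3) by (auto split: if_splits)
    with le show ?thesis by simp
  qed
  have "\<exists>D. finite D \<and> D \<subseteq> topspace X \<and> topspace X \<subseteq> (\<Union>x\<in>D. S k x)" for k
  proof -
    have "compactin X (topspace X)"
      using X(1) by (simp add: compact_space_def)
    moreover have "topspace X \<subseteq> \<Union>(S k ` topspace X)"
      using S_self by blast
    ultimately have "\<exists>\<F>. finite \<F> \<and> \<F> \<subseteq> S k ` topspace X \<and> topspace X \<subseteq> \<Union>\<F>"
      using S_open by (intro compactinD) auto
    then obtain \<F> where \<F>: "finite \<F>" "\<F> \<subseteq> S k ` topspace X" "topspace X \<subseteq> \<Union>\<F>"
      by blast
    from finite_subset_image[OF \<F>(1,2)] \<F>(3) show ?thesis by blast
  qed
  then obtain D where D: "\<And>k. finite (D k)" "\<And>k. D k \<subseteq> topspace X"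
      "\<And>k. topspace X \<subseteq> (\<Union>x\<in>D k. S k x)"
    by metis
  define \<C> where "\<C> k = S k ` D k" for k
  define B where "B = (\<Union>k. \<C> k)"
  have \<C>_fine: "C \<subseteq> R m" if "C \<in> \<C> k" "m < k" "z \<in> C" "z \<in> P m" for C k m z
    using that S_fine unfolding \<C>_def by blast
  have "topology_base X B"
    unfolding topology_base_def
  proof (intro conjI ballI allI impI)
    show "openin X V" if "V \<in> B" for V
      using that S_open by (auto simp: B_def \<C>_def)
    fix W x assume W: "openin X W \<and> x \<in> W"
    then obtain m where m: "x \<in> P m" "R m \<subseteq> W"
      using ex_m by blast
    have "x \<in> topspace X"
      using W openin_subset by blast
    then obtain C where C: "C \<in> \<C> (Suc m)" "x \<in> C"
      using D(3)[of "Suc m"] unfolding \<C>_def by blast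
    then have "C \<subseteq> R m"
      using \<C>_fine[of C "Suc m" m x] m(1) by simp
    then show "\<exists>V\<in>B. x \<in> V \<and> V \<subseteq> W"
      using C m(2) unfolding B_def by blast
  qed
  moreover have "finite {V \<in> B. U \<subseteq> V}" if U: "U \<in> B" for U
  proof -
    have "openin X U"
      using U S_open by (auto simp: B_def \<C>_def)
    have "U \<noteq> {}"
      using U S_self D(2) unfolding B_def \<C>_def by blast
    then obtain x where x: "x \<in> U"
      by blast
    then have "x \<in> topspace X"
      using \<open>openin X U\<close> openin_subset by blast
    \<comment> \<open>An isolated point needs \<open>W = {x}\<close>; otherwise \<open>W\<close> omits another point of \<open>U\<close>.\<close>
    have "\<exists>W. openin X W \<and> x \<in> W \<and> (\<forall>V. U \<subseteq> V \<and> V \<subseteq> W \<longrightarrow> V = U)"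
    proof (cases "U = {x}")
      case True
      then show ?thesis
        using \<open>openin X U\<close> by (intro exI[of _ U]) auto
    next
      case False
      then obtain y where y: "y \<in> U" "y \<noteq> x"
        using x by blast
      then have "y \<in> topspace X"
        using \<open>openin X U\<close> openin_subset by blast
      then have "openin X (topspace X - {y})"
        using X(2) by (simp add: closedin_Hausdorff_singleton openin_diff)
      then show ?thesis
        using y \<open>x \<in> topspace X\<close> by (intro exI[of _ "topspace X - {y}"]) auto
    qed
    then obtain W where W: "openin X W" "x \<in> W" "\<And>V. U \<subseteq> V \<Longrightarrow> V \<subseteq> W \<Longrightarrow> V = U"
      by blast
    obtain m where m: "x \<in> P m" "R m \<subseteq> W"
      using ex_m[OF W(1,2)] by blast
    have "{V \<in> B. U \<subseteq> V} \<subseteq> insert U (\<Union>k\<le>m. \<C> k)"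
    proof
      fix V assume "V \<in> {V \<in> B. U \<subseteq> V}"
      then obtain k where V: "V \<in> \<C> k" "U \<subseteq> V"
        unfolding B_def by blast
      show "V \<in> insert U (\<Union>k\<le>m. \<C> k)"
      proof (cases "k \<le> m")
        case False
        then have "V \<subseteq> R m"
          using V x m(1) by (intro \<C>_fine[of V k m x]) auto
        then have "V = U"
          using W(3)[OF V(2)] m(2) by blast
        then show ?thesis by simp
      qed (use V in blast)
    qed
    moreover have "finite (insert U (\<Union>k\<le>m. \<C> k))"
      using D(1) by (simp add: \<C>_def)
    ultimately show ?thesis
      by (rule finite_subset)
  qed
  ultimately show thesis
    by (rule that)
qed

section \<open>Noetherian type of powers\<close>

lemma card_of_finite_UNION_ordLess:
  assumes "finite I" "Card_order \<kappa>" "cinfinite \<kappa>" "\<And>i. i \<in> I \<Longrightarrow> |A i| <o \<kappa>"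
  shows "|\<Union>i\<in>I. A i| <o \<kappa>"
  using assms(1,4)
proof (induction I)
  case empty
  then show ?case
    using assms(2,3) by (simp add: ordLess_finite)
next
  case (insert i I)
  then have "|A i \<union> (\<Union>i\<in>I. A i)| <o \<kappa>"
    using assms(2,3) by (intro card_of_Un_ordLess_infinite_Field) (auto simp: cinfinite_def)
  then show ?case by simp
qed

text \<open>
  The boxes over a \<open>\<nu>\<close>-op-like base of \<open>X\<close> form a \<open>\<nu>\<close>-op-like base of the power, because a box
  above a given nonempty one is a tuple of basic sets above its sides, and \<open>\<nu>\<close> is infinite. Empty
  sides are discarded: every box would contain the empty one.
\<close>

lemma noetherian_type_power_le:
  "noetherian_type (product_topology (\<lambda>_. X) {..<n::nat}) \<le>o noetherian_type X"
proof -
  define \<nu> where "\<nu> = noetherian_type X"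
  have \<nu>: "Card_order \<nu>" "cinfinite \<nu>"
    by (simp_all add: \<nu>_def Card_order_noetherian_type cinfinite_noetherian_type)
  obtain B where B: "topology_base X B" "op_like \<nu> B"
    using noetherian_type_attained[of X] unfolding \<nu>_def by blast
  define \<B> where "\<B> = Pi\<^sub>E {..<n} ` ({..<n} \<rightarrow>\<^sub>E (B - {{}}))"
  have "topology_base (product_topology (\<lambda>_. X) {..<n}) \<B>"
    unfolding topology_base_def
  proof (intro conjI ballI allI impI)
    show "openin (product_topology (\<lambda>_. X) {..<n}) V" if V: "V \<in> \<B>" for V
    proof -
      obtain S where S: "V = Pi\<^sub>E {..<n} S" "S \<in> {..<n} \<rightarrow>\<^sub>E (B - {{}})"
        using V by (auto simp: \<B>_def)
      have "openin X (S i)" if "i < n" for i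
        using PiE_mem[OF S(2), of i] that B(1) by (simp add: topology_base_def)
      then show ?thesis
        using S(1) by (simp add: openin_PiE)
    qed
    fix U x assume "openin (product_topology (\<lambda>_. X) {..<n}) U \<and> x \<in> U"
    then obtain T where T: "x \<in> Pi\<^sub>E {..<n} T" "\<And>i. openin X (T i)" "Pi\<^sub>E {..<n} T \<subseteq> U"
      using product_topology_open_contains_basis[of "\<lambda>_. X" "{..<n}" U x] by auto
    have "\<exists>S\<in>B. x i \<in> S \<and> S \<subseteq> T i" if "i < n" for i
      using B(1) T(2)[of i] PiE_mem[OF T(1), of i] that unfolding topology_base_def by simp
    then obtain S where S: "\<And>i. i < n \<Longrightarrow> S i \<in> B \<and> x i \<in> S i \<and> S i \<subseteq> T i"
      by metis
    have "S i \<in> B - {{}}" if "i < n" for i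
      using S[OF that] by blast
    then have "Pi\<^sub>E {..<n} (restrict S {..<n}) \<in> \<B>"
      unfolding \<B>_def by (intro imageI restrict_PiE_iff[THEN iffD2] ballI) simp
    moreover have "x \<in> Pi\<^sub>E {..<n} (restrict S {..<n})"
      using S T(1) by (auto simp: PiE_iff)
    moreover have "Pi\<^sub>E {..<n} (restrict S {..<n}) \<subseteq> U"
      using S by (intro order_trans[OF PiE_mono T(3)]) simp
    ultimately show "\<exists>V\<in>\<B>. x \<in> V \<and> V \<subseteq> U"
      by blast
  qed
  moreover have "op_like \<nu> \<B>"
    unfolding op_like_def
  proof
    fix U assume "U \<in> \<B>"
    then obtain S where S: "U = Pi\<^sub>E {..<n} S" "S \<in> {..<n} \<rightarrow>\<^sub>E (B - {{}})"
      by (auto simp: \<B>_def)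
    have S_B: "S i \<in> B" "S i \<noteq> {}" if "i < n" for i
      using PiE_mem[OF S(2), of i] that by simp_all
    define A where "A = (\<Union>i\<in>{..<n}. {T \<in> B. S i \<subseteq> T})"
    have "{V \<in> \<B>. U \<subseteq> V} \<subseteq> Pi\<^sub>E {..<n} ` ({..<n} \<rightarrow>\<^sub>E A)"
    proof
      fix V assume V: "V \<in> {V \<in> \<B>. U \<subseteq> V}"
      then obtain T where T: "V = Pi\<^sub>E {..<n} T" "T \<in> {..<n} \<rightarrow>\<^sub>E (B - {{}})"
        by (auto simp: \<B>_def)
      have "Pi\<^sub>E {..<n} S \<subseteq> Pi\<^sub>E {..<n} T"
        using V S(1) T(1) by simp
      moreover have "Pi\<^sub>E {..<n} S \<noteq> {}"
        using S_B(2) by (simp add: PiE_eq_empty_iff)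
      ultimately have le: "S i \<subseteq> T i" if "i < n" for i
        using that by (simp add: subset_PiE)
      have "T i \<in> A" if "i < n" for i
        using PiE_mem[OF T(2), of i] le[OF that] that unfolding A_def by (intro UN_I[of i]) simp_all
      then have "T \<in> {..<n} \<rightarrow>\<^sub>E A"
        using T(2) by (simp add: PiE_iff)
      then show "V \<in> Pi\<^sub>E {..<n} ` ({..<n} \<rightarrow>\<^sub>E A)"
        using T(1) by blast
    qed
    then have "|{V \<in> \<B>. U \<subseteq> V}| \<le>o |Pi\<^sub>E {..<n} ` ({..<n} \<rightarrow>\<^sub>E A)|"
      by (rule card_of_mono1)
    also have "|Pi\<^sub>E {..<n} ` ({..<n} \<rightarrow>\<^sub>E A)| \<le>o |{..<n} \<rightarrow>\<^sub>E A|"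
      by (rule card_of_image)
    also have "|{..<n} \<rightarrow>\<^sub>E A| <o \<nu>"
    proof (rule card_of_tuples_ordLess[OF \<nu>])
      show "|A| <o \<nu>"
        unfolding A_def using \<nu> S_B(1) B(2)
        by (intro card_of_finite_UNION_ordLess) (auto simp: op_like_def)
    qed
    finally show "|{V \<in> \<B>. U \<subseteq> V}| <o \<nu>" .
  qed
  ultimately show ?thesis
    using noetherian_type_least[OF \<nu>] unfolding \<nu>_def by blast
qed

lemma maps_onto_cube_if_power_op_like:
  fixes X :: "'a topology" and I :: "'i set"
  assumes X: "compact_space X" "Hausdorff_space X"
    and weight: "natLeq <o weight X" "regularCard (weight X)"
    and I: "finite I" "I \<noteq> {}"
    and B: "topology_base (product_topology (\<lambda>_. X) I) B" "op_like (weight X) B"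
  shows "\<exists>f. continuous_map X
      (product_topology (\<lambda>_. top_of_set {0..1::real}) (Field (weight X))) f \<and>
    f ` topspace X = topspace (product_topology (\<lambda>_. top_of_set {0..1::real}) (Field (weight X)))"
proof -
  note \<kappa> = Card_order_weight[of X]
  have inf: "cinfinite (weight X)"
    using \<kappa> weight(1) by (rule cinfinite_if_natLeq_less)
  have "topspace X \<noteq> {}"
  proof
    assume "topspace X = {}"
    then have "topology_base X {}"
      by (rule topology_base_empty)
    then have "weight X \<le>o |{} :: 'a set set|"
      by (rule weight_least)
    moreover have "|{} :: 'a set set| <o weight X"
      using \<kappa> inf by (simp add: ordLess_finite)
    ultimately show False
      using not_ordLess_ordLeq by blast
  qed
  then obtain G where G: "openin X G" "G \<noteq> {}"
    and split: "\<forall>\<A>. |\<A>| <o weight X \<and> (\<forall>U\<in>\<A>. openin X U \<and> U \<noteq> {} \<and> U \<subseteq> G) \<longrightarrow>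
      (\<exists>p. splitting_pair X \<A> p)"
    using ex_open_set_split_everywhere[OF X _ \<kappa> weight ordLeq_refl[OF \<kappa>] I B] by blast
  obtain P where P: "independent_pairs G P" "\<And>p. p \<in> P \<Longrightarrow> splitting_pair X {} p" "weight X \<le>o |P|"
    using ex_independent_pairs[OF \<kappa> inf G] split by blast
  have "infinite (Field (weight X))"
    using inf by (simp add: cinfinite_def)
  moreover have "|Field (weight X)| \<le>o |P|"
    using card_of_Field_ordIso[OF \<kappa>] P(3) by (rule ordIso_ordLeq_trans)
  moreover have "normal_space X"
    using X compact_Hausdorff_or_regular_imp_normal_space by blast
  ultimately show ?thesis
    using X(1) G(1) P(1,2) by (intro independent_pairs_maps_onto_cube)
qed

theorem theorem2p25:
  fixes X :: "'a topology" and n :: nat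
  assumes "compact_space X" and "Hausdorff_space X"
    and "cinfinite (weight X)" and "regularCard (weight X)"
    and "\<not> (\<exists>f. continuous_map X
                (product_topology (\<lambda>_. top_of_set {0..1::real}) (Field (weight X))) f \<and>
              f ` topspace X =
                topspace (product_topology (\<lambda>_. top_of_set {0..1::real}) (Field (weight X))))"
    and "n > 0"
  shows "noetherian_type (product_topology (\<lambda>_. X) {..<n}) =o noetherian_type X"
proof -
  define \<nu> where "\<nu> = noetherian_type (product_topology (\<lambda>_. X) {..<n})"
  have \<nu>: "Card_order \<nu>" "cinfinite \<nu>"
    by (simp_all add: \<nu>_def Card_order_noetherian_type cinfinite_noetherian_type)
  obtain E where E: "topology_base X E" "|E| =o weight X"
    using weight_attained by blast
  have "noetherian_type X \<le>o \<nu>"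
  proof (cases "natLeq <o weight X")
    case False
    then have "weight X \<le>o natLeq"
      using Card_order_weight[of X] natLeq_Card_order
      by (meson card_order_on_well_order_on not_ordLess_iff_ordLeq)
    then have "|E| \<le>o |UNIV :: nat set|"
      using E(2) card_of_nat by (meson ordIso_ordLeq_trans ordIso_symmetric ordLeq_ordIso_trans)
    then have "countable E"
      by (auto simp: countable_def card_of_ordLeq[symmetric])
    then obtain B where B: "topology_base X B" "\<And>U. U \<in> B \<Longrightarrow> finite {V \<in> B. U \<subseteq> V}"
      using second_countable_compact_base[OF assms(1,2) E(1)] by blast
    then have "op_like \<nu> B"
      using \<nu> by (simp add: op_like_def ordLess_finite)
    then show ?thesis
      by (rule noetherian_type_least[OF \<nu> B(1)])
  next
    case True
    have "\<not> \<nu> \<le>o weight X"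
    proof
      assume le: "\<nu> \<le>o weight X"
      obtain B where B: "topology_base (product_topology (\<lambda>_. X) {..<n}) B" "op_like \<nu> B"
        using noetherian_type_attained[of "product_topology (\<lambda>_. X) {..<n}"] unfolding \<nu>_def by blast
      have "op_like (weight X) B"
        using B(2) le unfolding op_like_def by (meson ordLess_ordLeq_trans)
      moreover have "{..<n} \<noteq> {}"
        using assms(6) by auto
      ultimately show False
        using maps_onto_cube_if_power_op_like[OF assms(1,2) True assms(4) _ _ B(1)] assms(5) by blast
    qed
    then have "weight X <o \<nu>"
      using \<nu>(1) Card_order_weight[of X] by (meson card_order_on_well_order_on not_ordLeq_iff_ordLess)
    have "op_like \<nu> E"
      unfolding op_like_def
    proof
      fix U
      have "|{V \<in> E. U \<subseteq> V}| \<le>o |E|"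
        by (rule card_of_mono1) blast
      also have "|E| =o weight X"
        by (rule E(2))
      finally show "|{V \<in> E. U \<subseteq> V}| <o \<nu>"
        using \<open>weight X <o \<nu>\<close> by (rule ordLeq_ordLess_trans)
    qed
    then show ?thesis
      by (rule noetherian_type_least[OF \<nu> E(1)])
  qed
  then show ?thesis
    using noetherian_type_power_le[of X n] unfolding \<nu>_def by (simp add: ordIso_iff_ordLeq)
qed

end
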